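(* Let $\beta>1$ and $f_\beta:\mathbb{R}\to\mathbb{R}$, $f_\beta(x)=\sum_{l=0}^\infty 2^{-l\beta}\{2^lx\}$, where $\{x\}=x-[x]-\frac12$. The lower spectrum of singularities of $f_\beta$ is \[ \underline d(h)=\begin{cases}\dfrac h\beta & \text{if } h\in[0,\beta],\\ -\infty&\text{otherwise.}\end{cases} \]
   Context: $[x]$ denotes the integer part (floor) of $x$. For a locally bounded $f:\mathbb{R}\to\mathbb{R}$, $x_0\in\mathbb{R}$ and $\alpha\ge0$, $f\in C^\alpha(x_0)$ if there are $C,R>0$ and a polynomial $P$ of degree less than $\alpha$ with $\|f-P\|_{L^\infty(B(x_0,r))}\le Cr^\alpha$ for all $0<r\le R$. The lower Hölder exponent is $\underline h_f(x_0)=\sup\{\alpha:f\in C^\alpha(x_0)\}$. The lower spectrum of singularities of $f$ is $\underline d:[0,\infty]\to[0,\infty)\cup\{-\infty\}$, $\underline d(h)=\dim_{\mathcal H}\{x\in\mathbb{R}:\underline h_f(x)=h\}$, where $\dim_{\mathcal H}$ is the Hausdorff dimension and $\dim_{\mathcal H}\emptyset=-\infty$. *)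

theory Defs
  imports "HOL-Analysis.Analysis" "HOL-Probability.Essential_Supremum"
    "HOL-Computational_Algebra.Polynomial"
begin

text \<open>The cost of a set in a cover is its diameter to the power \<open>s\<close>. Since \<open>0 powr 0 = 0\<close> and
  \<open>diameter {} = 0\<close>, the exponent \<open>0\<close> and the empty set are treated separately: with \<open>s = 0\<close> every
  nonempty set costs \<open>1\<close>, so that \<open>hausdorff_measure 0\<close> is the counting measure.\<close>

definition hausdorff_cost :: "real \<Rightarrow> 'a::metric_space set \<Rightarrow> ennreal" where
  "hausdorff_cost s U =
     (if U = {} then 0 else if s = 0 then 1 else ennreal (diameter U powr s))"

text \<open>The library's \<open>diameter\<close> is real-valued and only meaningful on bounded sets, hence the
  boundedness condition. Finite covers are included by padding with empty sets.\<close>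

definition hausdorff_covers :: "real \<Rightarrow> 'a::metric_space set \<Rightarrow> (nat \<Rightarrow> 'a set) set" where
  "hausdorff_covers \<delta> A =
     {U. A \<subseteq> (\<Union>i. U i) \<and> (\<forall>i. bounded (U i) \<and> diameter (U i) \<le> \<delta>)}"

definition hausdorff_premeasure :: "real \<Rightarrow> real \<Rightarrow> 'a::metric_space set \<Rightarrow> ennreal" where
  "hausdorff_premeasure s \<delta> A = (INF U \<in> hausdorff_covers \<delta> A. \<Sum>i. hausdorff_cost s (U i))"

definition hausdorff_measure :: "real \<Rightarrow> 'a::metric_space set \<Rightarrow> ennreal" where
  "hausdorff_measure s A = (SUP \<delta> \<in> {0<..}. hausdorff_premeasure s \<delta> A)"

definition hausdorff_dim :: "'a::metric_space set \<Rightarrow> ereal" where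
  "hausdorff_dim A =
     (if A = {} then -\<infinity> else Inf {ereal s | s. 0 \<le> s \<and> hausdorff_measure s A = 0})"

text \<open>The zero polynomial has degree \<open>-\<infinity>\<close> here, whereas \<open>degree 0 = 0\<close> in the library. In
  particular it is the only polynomial allowed when \<open>\<alpha> = 0\<close>.\<close>

definition pointwise_holder :: "real \<Rightarrow> real \<Rightarrow> (real \<Rightarrow> real) set" where
  "pointwise_holder \<alpha> x0 =
     {f. \<exists>C>0. \<exists>R>0. \<exists>P :: real poly. (P = 0 \<or> real (degree P) < \<alpha>) \<and>
        (\<forall>r. 0 < r \<and> r \<le> R \<longrightarrow>
           esssup (lebesgue_on (ball x0 r)) (\<lambda>x. ereal \<bar>f x - poly P x\<bar>) \<le> ereal (C * r powr \<alpha>))}"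

definition lower_holder_exponent :: "(real \<Rightarrow> real) \<Rightarrow> real \<Rightarrow> ereal" where
  "lower_holder_exponent f x0 = Sup {ereal \<alpha> | \<alpha>. 0 \<le> \<alpha> \<and> f \<in> pointwise_holder \<alpha> x0}"

definition lower_spectrum :: "(real \<Rightarrow> real) \<Rightarrow> ereal \<Rightarrow> ereal" where
  "lower_spectrum f h = hausdorff_dim {x. lower_holder_exponent f x = h}"

definition sawtooth :: "real \<Rightarrow> real" where
  "sawtooth x = x - of_int \<lfloor>x\<rfloor> - 1 / 2"

definition sawtooth_series :: "real \<Rightarrow> real \<Rightarrow> real" where
  "sawtooth_series \<beta> x = (\<Sum>l. 2 powr (- real l * \<beta>) * sawtooth (2 ^ l * x))"

lemma summable_sawtooth_series:
  assumes "\<beta> > 0"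
  shows "summable (\<lambda>l. 2 powr (- real l * \<beta>) * sawtooth (2 ^ l * x))"
proof (rule summable_comparison_test')
  have "2 powr (- \<beta>) < (1::real)"
    using assms by (simp add: powr_less_one)
  then show "summable (\<lambda>l. (2 powr (- \<beta>)) ^ l :: real)"
    by (intro summable_geometric) simp
  fix l :: nat
  have "(2 powr (- \<beta>)) ^ l = (2 powr (- real l * \<beta>) :: real)"
    by (simp add: powr_powr mult.commute flip: powr_realpow)
  moreover have "\<bar>sawtooth y\<bar> \<le> 1" for y
    unfolding sawtooth_def by linarith
  ultimately show "norm (2 powr (- real l * \<beta>) * sawtooth (2 ^ l * x)) \<le> (2 powr (- \<beta>)) ^ l"
    by (simp add: abs_mult mult_left_le)
qed

end

theory Submission
  imports Defs "HOL-Real_Asymp.Real_Asymp"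
begin

text \<open>Since \<open>\<beta> > 1\<close>, the series differs from a linear function by the increasing function
  \<open>x \<mapsto> \<Sum>l. 2 powr (- l * \<beta>) * \<lfloor>2 ^ l * x\<rfloor>\<close>, which jumps by at least \<open>2 powr (- l * \<beta>)\<close> at every
  dyadic number \<open>k / 2 ^ l\<close>. Hence the exponent at \<open>x\<close> is determined by dyadic approximation: it is
  \<open>\<beta> / \<tau>\<close>, where \<open>\<tau> \<ge> 1\<close> is the supremum of the exponents for which \<open>x\<close> is within
  \<open>2 powr (- l * \<tau>)\<close> of some \<open>k / 2 ^ l\<close> for infinitely many \<open>l\<close>. The points with approximation
  exponent at least \<open>\<tau>\<close> have dimension at most \<open>1 / \<tau>\<close> by the obvious covers. For the lower bound, fix
  the binary digits in a set of positions so that \<open>x\<close> has exponent exactly \<open>\<tau>\<close> and at least about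
  \<open>n / \<tau>\<close> of the first \<open>n\<close> digits stay free. Reading off the free digits is a map onto the unit
  interval that is Hoelder continuous with every exponent below \<open>1 / \<tau>\<close>, so the dimension is at least
  \<open>1 / \<tau>\<close>.\<close>

section \<open>Jumps of the sawtooth series\<close>

lemma summable_powr_mult:
  fixes c :: real
  assumes "c < 0"
  shows "summable (\<lambda>l. 2 powr (real l * c))"
proof -
  have "2 powr (real l * c) = (2 powr c) ^ l" for l
    by (simp add: powr_powr mult.commute flip: powr_realpow)
  moreover have "2 powr c < 1"
    using assms by (simp add: powr_less_one)
  ultimately show ?thesis
    by (simp add: summable_geometric)
qed

lemma powr_mult_power2: "2 powr (- real l * \<beta>) * 2 ^ l = 2 powr (real l * (1 - \<beta>))"
  by (simp add: algebra_simps flip: powr_realpow powr_add)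

text \<open>The slopes \<open>2 powr (- l * \<beta>) * 2 ^ l\<close> of the terms between their
  jumps, summed over all levels; convergent for \<beta> > 1.\<close>

definition sawtooth_slope :: "real \<Rightarrow> real" where
  "sawtooth_slope \<beta> = (\<Sum>l. 2 powr (real l * (1 - \<beta>)))"

lemma sawtooth_slope_pos:
  assumes "\<beta> > 1"
  shows "sawtooth_slope \<beta> > 0"
  unfolding sawtooth_slope_def
  by (rule suminf_pos) (use assms in \<open>auto intro: summable_powr_mult\<close>)

text \<open>A sawtooth is linear minus a floor minus \<open>1 / 2\<close>. In a difference the
  constants cancel, the linear parts sum to the slope, and only floor increments remain, all
  nonnegative for \<open>x \<le> y\<close>.\<close>

lemma sawtooth_series_diff:
  assumes "\<beta> > 1"
  shows "(\<lambda>l. 2 powr (- real l * \<beta>) * of_int (\<lfloor>2 ^ l * y\<rfloor> - \<lfloor>2 ^ l * x\<rfloor>)) sums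
           (sawtooth_slope \<beta> * (y - x) - (sawtooth_series \<beta> y - sawtooth_series \<beta> x))"
proof -
  have "(\<lambda>l. 2 powr (real l * (1 - \<beta>)) * (y - x)) sums (sawtooth_slope \<beta> * (y - x))"
    unfolding sawtooth_slope_def
    by (intro sums_mult2 summable_sums summable_powr_mult) (use assms in auto)
  moreover have "(\<lambda>l. 2 powr (- real l * \<beta>) * sawtooth (2 ^ l * z)) sums sawtooth_series \<beta> z" for z
    unfolding sawtooth_series_def by (intro summable_sums summable_sawtooth_series) (use assms in auto)
  ultimately have "(\<lambda>l. 2 powr (real l * (1 - \<beta>)) * (y - x) -
       (2 powr (- real l * \<beta>) * sawtooth (2 ^ l * y) - 2 powr (- real l * \<beta>) * sawtooth (2 ^ l * x)))
     sums (sawtooth_slope \<beta> * (y - x) - (sawtooth_series \<beta> y - sawtooth_series \<beta> x))"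
    by (intro sums_diff)
  moreover have "2 powr (real l * (1 - \<beta>)) * (y - x) -
       (2 powr (- real l * \<beta>) * sawtooth (2 ^ l * y) - 2 powr (- real l * \<beta>) * sawtooth (2 ^ l * x))
     = 2 powr (- real l * \<beta>) * of_int (\<lfloor>2 ^ l * y\<rfloor> - \<lfloor>2 ^ l * x\<rfloor>)" for l
    unfolding powr_mult_power2[symmetric] sawtooth_def by (simp add: algebra_simps)
  ultimately show ?thesis
    by simp
qed

text \<open>All floor increments from y to x are nonnegative, so the sum is at least its term at
  level l, where crossing p raises the floor. The strict \<open>y < p\<close> and the weak
  \<open>p \<le> x\<close> match the right continuity of the floor.\<close>

lemma sawtooth_series_drop:
  assumes "\<beta> > 1" "y < p" "p \<le> x" "2 ^ l * p = of_int k"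
  shows "2 powr (- real l * \<beta>) \<le> sawtooth_slope \<beta> * (x - y) - (sawtooth_series \<beta> x - sawtooth_series \<beta> y)"
proof -
  let ?a = "\<lambda>j. 2 powr (- real j * \<beta>) * of_int (\<lfloor>2 ^ j * x\<rfloor> - \<lfloor>2 ^ j * y\<rfloor>)"
  note s = sawtooth_series_diff[OF assms(1), of x y]
  have nn: "0 \<le> ?a j" for j
    using assms by (intro mult_nonneg_nonneg) (auto intro!: floor_mono)
  have "\<lfloor>2 ^ l * y\<rfloor> < k"
    using assms by (simp add: floor_less_iff flip: assms(4))
  moreover have "k \<le> \<lfloor>2 ^ l * x\<rfloor>"
    using assms by (simp add: le_floor_iff flip: assms(4))
  ultimately have "1 \<le> \<lfloor>2 ^ l * x\<rfloor> - \<lfloor>2 ^ l * y\<rfloor>"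
    by linarith
  then have "(1::real) \<le> of_int (\<lfloor>2 ^ l * x\<rfloor> - \<lfloor>2 ^ l * y\<rfloor>)"
    by linarith
  then have "2 powr (- real l * \<beta>) \<le> ?a l"
    using mult_left_mono[of 1 "of_int (\<lfloor>2 ^ l * x\<rfloor> - \<lfloor>2 ^ l * y\<rfloor>)" "2 powr (- real l * \<beta>)"] by simp
  also have "?a l \<le> suminf ?a"
    using sum_le_suminf[OF sums_summable[OF s], of "{l}"] nn by simp
  also have "suminf ?a = sawtooth_slope \<beta> * (x - y) - (sawtooth_series \<beta> x - sawtooth_series \<beta> y)"
    using s by (rule sums_unique[symmetric])
  finally show ?thesis .
qed

lemma sawtooth_series_measurable [measurable]: "sawtooth_series \<beta> \<in> borel_measurable borel"
  unfolding sawtooth_series_def sawtooth_def by measurable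

lemma holder_deviation_measurable:
  "(\<lambda>x. ereal \<bar>sawtooth_series \<beta> x - poly P x\<bar>) \<in> borel_measurable (lebesgue_on (ball x0 r))"
proof -
  have [measurable]: "poly P \<in> borel_measurable borel"
    by (intro borel_measurable_continuous_onI continuous_intros)
  have "(\<lambda>x. ereal \<bar>sawtooth_series \<beta> x - poly P x\<bar>) \<in> borel_measurable borel"
    by measurable
  then show ?thesis
    by (intro measurable_restrict_space1 measurable_completion) simp
qed

text \<open>An interval has positive measure and so is not contained in an exceptional null set.
  This turns an essential bound into pointwise bounds on either side of a jump.\<close>

lemma AE_lebesgue_on_ball_dense:
  fixes a b x0 r :: real
  assumes "AE x in lebesgue_on (ball x0 r). Q x" "a < b" "{a<..<b} \<subseteq> ball x0 r"
  shows "\<exists>x\<in>{a<..<b}. Q x"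
proof (rule ccontr)
  assume H: "\<not> ?thesis"
  have "AE x in lebesgue. x \<in> ball x0 r \<longrightarrow> Q x"
    using assms(1) by (subst (asm) AE_restrict_space_iff) auto
  then have "AE x in lebesgue. x \<notin> {a<..<b}"
    by eventually_elim (use H assms(3) in blast)
  then have "emeasure lebesgue {a<..<b} = 0"
    by (subst (asm) AE_iff_measurable[of "{a<..<b}"]) auto
  with assms(2) show False
    by simp
qed

text \<open>No polynomial removes a jump: the deviation is a continuous function minus an increasing
  one that jumps at p. Nearby points on both sides of p with deviation at most c bound the jump by
  \<open>2 * c\<close> up to an arbitrarily small error.\<close>

lemma pointwise_holder_jump:
  assumes "\<beta> > 1" "r > 0" "p \<in> ball x0 r" "2 ^ l * p = of_int k"
  assumes ess: "esssup (lebesgue_on (ball x0 r)) (\<lambda>x. ereal \<bar>sawtooth_series \<beta> x - poly P x\<bar>) \<le> ereal c"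
  shows "2 powr (- real l * \<beta>) \<le> 2 * c"
proof (rule field_le_epsilon)
  fix e :: real assume "e > 0"
  have ae: "AE x in lebesgue_on (ball x0 r). ereal \<bar>sawtooth_series \<beta> x - poly P x\<bar> \<le> ereal c"
    using esssup_AE[where f = "\<lambda>x. ereal \<bar>sawtooth_series \<beta> x - poly P x\<bar>"] by eventually_elim (use ess order_trans in blast)
  have "isCont (\<lambda>x. sawtooth_slope \<beta> * x - poly P x) p"
    by (intro continuous_intros)
  then obtain d where d: "d > 0" and cont: "\<And>x. \<bar>x - p\<bar> < d \<Longrightarrow>
     \<bar>(sawtooth_slope \<beta> * x - poly P x) - (sawtooth_slope \<beta> * p - poly P p)\<bar> < e / 2"
    using \<open>e > 0\<close> unfolding continuous_at_eps_delta dist_real_def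
    by (metis half_gt_zero)
  obtain d' where d': "d' > 0" "ball p d' \<subseteq> ball x0 r"
    using assms(3) by (metis open_ball open_contains_ball)
  define m where "m = min d d'"
  have m: "m > 0" "m \<le> d" "m \<le> d'"
    using d d' by (auto simp: m_def)
  have "{p<..<p+m} \<subseteq> ball x0 r" "{p-m<..<p} \<subseteq> ball x0 r"
    using d' m by (force simp: dist_real_def subset_eq)+
  then obtain x y where x: "x \<in> {p<..<p+m}" "\<bar>sawtooth_series \<beta> x - poly P x\<bar> \<le> c"
    and y: "y \<in> {p-m<..<p}" "\<bar>sawtooth_series \<beta> y - poly P y\<bar> \<le> c"
    using AE_lebesgue_on_ball_dense[OF ae, of p "p+m"] AE_lebesgue_on_ball_dense[OF ae, of "p-m" p] m(1) by auto
  have xy: "\<bar>x - p\<bar> < d" "\<bar>y - p\<bar> < d"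
    using x(1) y(1) m by auto
  have "2 powr (- real l * \<beta>) \<le> sawtooth_slope \<beta> * (x - y) - (sawtooth_series \<beta> x - sawtooth_series \<beta> y)"
    using x y by (intro sawtooth_series_drop[where p = p and k = k]) (use assms in auto)
  then show "2 powr (- real l * \<beta>) \<le> 2 * c + e"
    using cont[of x] cont[of y] x(2) y(2) xy unfolding right_diff_distrib by linarith
qed

section \<open>Dyadic approximation and the lower exponent\<close>

text \<open>The distance from x to the grid of multiples of \<open>1 / 2 ^ l\<close>.\<close>

definition dyadic_dist :: "nat \<Rightarrow> real \<Rightarrow> real" where
  "dyadic_dist l x = \<bar>2 ^ l * x - of_int (round (2 ^ l * x))\<bar> / 2 ^ l"

lemma dyadic_dist_le: "dyadic_dist l x \<le> \<bar>x - of_int k / 2 ^ l\<bar>"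
proof -
  have "2 ^ l * dyadic_dist l x \<le> \<bar>2 ^ l * x - of_int k\<bar>"
    unfolding dyadic_dist_def using round_diff_minimal[of "2 ^ l * x" k] by simp
  also have "\<dots> = 2 ^ l * \<bar>x - of_int k / 2 ^ l\<bar>"
  proof -
    have "2 ^ l * x - of_int k = 2 ^ l * (x - of_int k / 2 ^ l)"
      by (simp add: field_simps)
    then show ?thesis
      by (simp add: abs_mult)
  qed
  finally show ?thesis
    by simp
qed

lemma dyadic_dist_eq: "dyadic_dist l x = \<bar>x - of_int (round (2 ^ l * x)) / 2 ^ l\<bar>"
proof -
  have "2 ^ l * x - of_int (round (2 ^ l * x)) = 2 ^ l * (x - of_int (round (2 ^ l * x)) / 2 ^ l)"
    by (simp add: field_simps)
  then show ?thesis
    unfolding dyadic_dist_def by (simp add: abs_mult)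
qed

lemma dyadic_dist_antimono: "l \<le> m \<Longrightarrow> dyadic_dist m x \<le> dyadic_dist l x"
proof (induction m rule: dec_induct)
  case (step n)
  have "dyadic_dist (Suc n) x \<le> \<bar>x - of_int (2 * round (2 ^ n * x)) / 2 ^ Suc n\<bar>"
    by (rule dyadic_dist_le)
  also have "\<dots> = dyadic_dist n x"
    by (simp add: dyadic_dist_eq)
  finally show ?case
    using step.IH by simp
qed simp

lemma dyadic_dist_le_half: "dyadic_dist l x \<le> 1 / 2 ^ l"
proof -
  have "\<bar>2 ^ l * x - of_int (round (2 ^ l * x))\<bar> \<le> 1 / 2"
    using of_int_round_abs_le[of "2 ^ l * x"] by (simp add: abs_minus_commute)
  then show ?thesis
    unfolding dyadic_dist_def by (intro divide_right_mono) auto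
qed

text \<open>The larger of the two floors, divided by \<open>2 ^ l\<close>, is a grid point between x
  and y.\<close>

lemma dyadic_dist_le_dist_floor_neq:
  assumes "\<lfloor>2 ^ l * y\<rfloor> \<noteq> \<lfloor>2 ^ l * x\<rfloor>"
  shows "dyadic_dist l x \<le> \<bar>y - x\<bar>"
proof (cases "y < x")
  case True
  then have "\<lfloor>2 ^ l * y\<rfloor> < \<lfloor>2 ^ l * x\<rfloor>"
    using assms floor_mono[of "2 ^ l * y" "2 ^ l * x"] by simp
  then have "y < of_int \<lfloor>2 ^ l * x\<rfloor> / 2 ^ l" "of_int \<lfloor>2 ^ l * x\<rfloor> / 2 ^ l \<le> x"
    by (simp_all add: floor_less_iff field_simps)
  then show ?thesis
    using dyadic_dist_le[of l x "\<lfloor>2 ^ l * x\<rfloor>"] by linarith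
next
  case False
  then have "\<lfloor>2 ^ l * x\<rfloor> < \<lfloor>2 ^ l * y\<rfloor>"
    using assms floor_mono[of "2 ^ l * x" "2 ^ l * y"] by simp
  then have "x < of_int \<lfloor>2 ^ l * y\<rfloor> / 2 ^ l" "of_int \<lfloor>2 ^ l * y\<rfloor> / 2 ^ l \<le> y"
    by (simp_all add: floor_less_iff field_simps)
  then show ?thesis
    using dyadic_dist_le[of l x "\<lfloor>2 ^ l * y\<rfloor>"] by linarith
qed

text \<open>The limsup set of the Jarnik-Besicovitch theorem with denominators restricted to powers
  of two.\<close>

definition dyadic_approximable :: "real \<Rightarrow> real set" where
  "dyadic_approximable \<tau> = {x. \<exists>\<^sub>F l in sequentially. dyadic_dist l x \<le> 2 powr (- real l * \<tau>)}"

section \<open>Upper bound for the exponent at well approximable points\<close>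

lemma tendsto_powr_mult_zero:
  fixes c :: real
  assumes "c < 0"
  shows "(\<lambda>l. 2 powr (real l * c)) \<longlonglongrightarrow> 0"
  using summable_LIMSEQ_zero[OF summable_powr_mult[OF assms]] .

text \<open>For infinitely many l a ball of radius about \<open>2 powr (- l * \<tau>)\<close>
  contains a jump of size at least \<open>2 powr (- l * \<beta>)\<close>, which Hoelder regularity
  bounds by a multiple of \<open>2 powr (- l * \<alpha> * \<tau>)\<close>. Large l then force the
  inequality of the exponents.\<close>

lemma pointwise_holder_exponent_le:
  assumes "\<beta> > 1" "\<tau> > 0" "0 \<le> \<alpha>" "x \<in> dyadic_approximable \<tau>"
    and "sawtooth_series \<beta> \<in> pointwise_holder \<alpha> x"
  shows "\<alpha> * \<tau> \<le> \<beta>"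
proof (rule ccontr)
  assume less: "\<not> \<alpha> * \<tau> \<le> \<beta>"
  obtain C R P where "C > 0" "R > 0" and
    H: "\<And>r. 0 < r \<Longrightarrow> r \<le> R \<Longrightarrow>
      esssup (lebesgue_on (ball x r)) (\<lambda>z. ereal \<bar>sawtooth_series \<beta> z - poly P z\<bar>) \<le> ereal (C * r powr \<alpha>)"
    using assms(5) unfolding pointwise_holder_def by auto
  \<comment> \<open>The factor 2 puts the nearest grid point, possibly at distance exactly
    \<open>2 powr (- l * \<tau>)\<close>, inside the open ball.\<close>
  let ?r = "\<lambda>l::nat. 2 * 2 powr (real l * (- \<tau>)) :: real"
  have "?r \<longlonglongrightarrow> 2 * 0"
    by (intro tendsto_intros tendsto_powr_mult_zero) (use assms in auto)
  then have ev1: "\<forall>\<^sub>F l in sequentially. ?r l < R"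
    using \<open>R > 0\<close> by (intro order_tendstoD) auto
  \<comment> \<open>Twice the Hoelder bound divided by the size of the jump: the jump forces this to
    be at least 1.\<close>
  have "(\<lambda>l. 2 * C * 2 powr \<alpha> * 2 powr (real l * (\<beta> - \<alpha> * \<tau>))) \<longlonglongrightarrow> 2 * C * 2 powr \<alpha> * 0"
    by (intro tendsto_intros tendsto_powr_mult_zero) (use less in auto)
  then have ev2: "\<forall>\<^sub>F l in sequentially. 2 * C * 2 powr \<alpha> * 2 powr (real l * (\<beta> - \<alpha> * \<tau>)) < 1"
    by (intro order_tendstoD) auto
  have "\<exists>\<^sub>F l in sequentially. dyadic_dist l x \<le> 2 powr (- real l * \<tau>) \<and> ?r l < R \<and>
      2 * C * 2 powr \<alpha> * 2 powr (real l * (\<beta> - \<alpha> * \<tau>)) < 1"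
    using assms(4) unfolding dyadic_approximable_def
    by (intro frequently_eventually_frequently eventually_conj ev1 ev2) auto
  then obtain l where l: "dyadic_dist l x \<le> 2 powr (- real l * \<tau>)" "?r l < R"
      "2 * C * 2 powr \<alpha> * 2 powr (real l * (\<beta> - \<alpha> * \<tau>)) < 1"
    using frequently_ex by blast
  let ?p = "of_int (round (2 ^ l * x)) / 2 ^ l :: real"
  have "dist x ?p = dyadic_dist l x"
    by (simp add: dyadic_dist_eq dist_real_def)
  also have "\<dots> < ?r l"
    by (rule le_less_trans[OF l(1)]) simp
  finally have "2 powr (- real l * \<beta>) \<le> 2 * (C * ?r l powr \<alpha>)"
    using l(2) by (intro pointwise_holder_jump[where p = ?p and ?x0.0 = x and r = "?r l" and P = P
          and k = "round (2 ^ l * x)"] H) (use assms in auto)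
  then have "2 powr (real l * \<beta>) * 2 powr (- real l * \<beta>) \<le> 2 powr (real l * \<beta>) * (2 * (C * ?r l powr \<alpha>))"
    by (rule mult_left_mono) simp
  also have "?r l powr \<alpha> = 2 powr \<alpha> * 2 powr (- real l * \<alpha> * \<tau>)"
    by (simp add: powr_mult powr_powr mult_ac)
  also have "2 powr (real l * \<beta>) * (2 * (C * (2 powr \<alpha> * 2 powr (- real l * \<alpha> * \<tau>)))) =
      2 * C * 2 powr \<alpha> * (2 powr (real l * \<beta>) * 2 powr (- real l * \<alpha> * \<tau>))"
    by (simp add: mult_ac)
  also have "2 powr (real l * \<beta>) * 2 powr (- real l * \<alpha> * \<tau>) = 2 powr (real l * (\<beta> - \<alpha> * \<tau>))"
    by (simp add: algebra_simps flip: powr_add)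
  finally show False
    using l(3) by (simp flip: powr_add)
qed

section \<open>Lower bound for the exponent by linear approximation\<close>

lemma sawtooth_series_linear_approx:
  assumes "\<beta> > 1" "\<And>l. l < L \<Longrightarrow> \<lfloor>2 ^ l * y\<rfloor> = \<lfloor>2 ^ l * x\<rfloor>" "\<bar>y - x\<bar> < 1"
  shows "\<bar>sawtooth_slope \<beta> * (y - x) - (sawtooth_series \<beta> y - sawtooth_series \<beta> x)\<bar>
     \<le> 3 * sawtooth_slope \<beta> * 2 powr (- real L * \<beta>)"
proof -
  \<comment> \<open>Equal floors at level \<open>L - 1\<close> give
    \<open>2 ^ (L - 1) * \<bar>y - x\<bar> < 1\<close>. For \<open>L = 0\<close> the assumption
    \<open>\<bar>y - x\<bar> < 1\<close> serves instead.\<close>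
  have close: "2 ^ L * \<bar>y - x\<bar> \<le> 2"
  proof (cases L)
    case (Suc n)
    have "\<bar>2 ^ n * y - 2 ^ n * x\<bar> < 1"
      using assms(2)[of n] Suc by linarith
    then have "2 ^ n * \<bar>y - x\<bar> < 1"
      by (simp add: abs_mult flip: right_diff_distrib)
    then show ?thesis
      using Suc by simp
  qed (use assms(3) in simp)
  let ?a = "\<lambda>l. 2 powr (- real l * \<beta>) * of_int (\<lfloor>2 ^ l * y\<rfloor> - \<lfloor>2 ^ l * x\<rfloor>)"
  note s = sawtooth_series_diff[OF assms(1), of y x]
  have "sawtooth_slope \<beta> * (y - x) - (sawtooth_series \<beta> y - sawtooth_series \<beta> x) = suminf ?a"
    by (rule sums_unique[OF s])
  also have "suminf ?a = (\<Sum>j. ?a (j + L)) + (\<Sum>l<L. ?a l)"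
    by (rule suminf_split_initial_segment[OF sums_summable[OF s]])
  also have "(\<Sum>l<L. ?a l) = 0"
    by (intro sum.neutral) (use assms(2) in auto)
  \<comment> \<open>From level L on the floor increments grow at most like \<open>2 ^ j\<close>, and
    for \<beta> > 1 the weights still leave a convergent series, that of
    \<open>sawtooth_slope\<close>.\<close>
  also have "norm ((\<Sum>j. ?a (j + L)) + 0) \<le> (\<Sum>j. 3 * 2 powr (- real L * \<beta>) * 2 powr (real j * (1 - \<beta>)))"
    unfolding add_0_right
  proof (rule norm_suminf_le)
    fix j
    have "\<bar>2 ^ (j + L) * y - 2 ^ (j + L) * x\<bar> = 2 ^ j * (2 ^ L * \<bar>y - x\<bar>)"
      by (simp add: abs_mult power_add flip: right_diff_distrib)
    also have "\<dots> \<le> 2 ^ j * 2"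
      by (rule mult_left_mono[OF close]) simp
    finally have "\<bar>of_int (\<lfloor>2 ^ (j + L) * y\<rfloor> - \<lfloor>2 ^ (j + L) * x\<rfloor>)\<bar> \<le> 3 * (2 ^ j :: real)"
      using one_le_power[of "2::real" j] by linarith
    then have "norm (?a (j + L)) \<le> 2 powr (- real (j + L) * \<beta>) * (3 * 2 ^ j)"
      unfolding real_norm_def abs_mult abs_of_nonneg[OF powr_ge_zero]
      by (rule mult_left_mono[OF _ powr_ge_zero])
    also have "\<dots> = 3 * 2 powr (- real L * \<beta>) * 2 powr (real j * (1 - \<beta>))"
      unfolding powr_mult_power2[symmetric] by (simp add: algebra_simps flip: powr_add)
    finally show "norm (?a (j + L)) \<le> 3 * 2 powr (- real L * \<beta>) * 2 powr (real j * (1 - \<beta>))" .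
  qed (use assms in \<open>auto intro!: summable_mult summable_powr_mult\<close>)
  also have "\<dots> = 3 * 2 powr (- real L * \<beta>) * sawtooth_slope \<beta>"
    unfolding sawtooth_slope_def by (intro suminf_mult summable_powr_mult) (use assms in auto)
  finally show ?thesis
    by (simp add: mult_ac)
qed

text \<open>Let L be the first level at which the floors of x and y differ. A grid point of that
  level lies within r of x, so \<open>2 powr (- L * \<tau>)\<close> is at most r, and the error
  \<open>2 powr (- L * \<beta>)\<close> of the linear approximation is at most
  \<open>r powr (\<beta> / \<tau>)\<close>.\<close>

lemma sawtooth_series_deviation:
  assumes "\<beta> > 1" "\<tau> > 0" "x \<notin> dyadic_approximable \<tau>"
  shows "\<exists>R>0. R \<le> 1 \<and> (\<forall>r y. 0 < r \<longrightarrow> r \<le> R \<longrightarrow> \<bar>y - x\<bar> < r \<longrightarrow>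
    \<bar>sawtooth_slope \<beta> * (y - x) - (sawtooth_series \<beta> y - sawtooth_series \<beta> x)\<bar>
       \<le> 3 * sawtooth_slope \<beta> * r powr (\<beta> / \<tau>))"
proof -
  obtain L0 where "\<forall>l\<ge>L0. \<not> dyadic_dist l x \<le> 2 powr (- real l * \<tau>)"
    using assms(3) unfolding dyadic_approximable_def frequently_def eventually_sequentially mem_Collect_eq not_not
    by (rule exE)
  then have L0: "2 powr (- real l * \<tau>) < dyadic_dist l x" if "l \<ge> L0" for l
    using that not_le by blast
  \<comment> \<open>Grid distances decrease with the level, so radii up to
    \<open>dyadic_dist L0 x\<close> exclude a first difference before L0. The bound 1 serves the
    linear approximation.\<close>
  define R where "R = min (dyadic_dist L0 x) 1"
  have "0 < dyadic_dist L0 x"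
    by (rule le_less_trans[OF _ L0[of L0]]) auto
  then have "R > 0" "R \<le> 1"
    by (auto simp: R_def)
  moreover have "\<bar>sawtooth_slope \<beta> * (y - x) - (sawtooth_series \<beta> y - sawtooth_series \<beta> x)\<bar>
       \<le> 3 * sawtooth_slope \<beta> * r powr (\<beta> / \<tau>)" if r: "0 < r" "r \<le> R" "\<bar>y - x\<bar> < r" for r y
  proof (cases "\<exists>l. \<lfloor>2 ^ l * y\<rfloor> \<noteq> \<lfloor>2 ^ l * x\<rfloor>")
    case False
    then show ?thesis
      using sums_unique2[OF sawtooth_series_diff[OF assms(1), of y x], of 0] sawtooth_slope_pos[OF assms(1)]
      by simp
  next
    case True
    define L where "L = (LEAST l. \<lfloor>2 ^ l * y\<rfloor> \<noteq> \<lfloor>2 ^ l * x\<rfloor>)"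
    have L: "\<lfloor>2 ^ L * y\<rfloor> \<noteq> \<lfloor>2 ^ L * x\<rfloor>"
      unfolding L_def by (rule LeastI_ex[OF True])
    have "\<lfloor>2 ^ l * y\<rfloor> = \<lfloor>2 ^ l * x\<rfloor>" if "l < L" for l
      using not_less_Least[OF that[unfolded L_def]] by simp
    then have "\<bar>sawtooth_slope \<beta> * (y - x) - (sawtooth_series \<beta> y - sawtooth_series \<beta> x)\<bar>
        \<le> 3 * sawtooth_slope \<beta> * 2 powr (- real L * \<beta>)"
      using r R_def by (intro sawtooth_series_linear_approx assms) auto
    also have "2 powr (- real L * \<beta>) \<le> r powr (\<beta> / \<tau>)"
    proof -
      have small: "dyadic_dist L x < r"
        using dyadic_dist_le_dist_floor_neq[OF L] r by simp
      then have "L0 \<le> L"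
        using dyadic_dist_antimono[of L L0 x] r R_def by (cases "L0 \<le> L") auto
      from L0[OF this] small have "2 powr (- real L * \<tau>) \<le> r"
        by simp
      then have "(2 powr (- real L * \<tau>)) powr (\<beta> / \<tau>) \<le> r powr (\<beta> / \<tau>)"
        by (rule powr_mono2[rotated 2]) (use assms in auto)
      then show ?thesis
        using assms by (simp add: powr_powr)
    qed
    finally show ?thesis
      using sawtooth_slope_pos[OF assms(1)] by simp
  qed
  ultimately show ?thesis
    by blast
qed

lemma pointwise_holder_sawtooth_series:
  assumes "\<beta> > 1" "\<tau> > 0" "x \<notin> dyadic_approximable \<tau>"
  shows "sawtooth_series \<beta> \<in> pointwise_holder (\<beta> / \<tau>) x"
proof -
  define D where "D = sawtooth_slope \<beta>"
  have "D > 0"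
    unfolding D_def by (rule sawtooth_slope_pos[OF assms(1)])
  let ?f = "sawtooth_series \<beta>"
  obtain R where R: "0 < R" "R \<le> 1" and dev: "\<And>r y. 0 < r \<Longrightarrow> r \<le> R \<Longrightarrow> \<bar>y - x\<bar> < r \<Longrightarrow>
     \<bar>D * (y - x) - (?f y - ?f x)\<bar> \<le> 3 * D * r powr (\<beta> / \<tau>)"
    using sawtooth_series_deviation[OF assms] unfolding D_def by blast
  \<comment> \<open>Degree 1 is admissible only for an exponent above 1. Otherwise a constant
    suffices: for \<open>r \<le> 1\<close> the linear term is at most
    \<open>D * r powr (\<beta> / \<tau>)\<close>, which raises the constant from 3 to 4.\<close>
  define P where "P = (if \<beta> / \<tau> > 1 then [:?f x - D * x, D:] else [:?f x:])"
  have "real (degree P) < \<beta> / \<tau>"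
    using assms by (auto simp: P_def)
  moreover have "esssup (lebesgue_on (ball x r)) (\<lambda>y. ereal \<bar>?f y - poly P y\<bar>) \<le> ereal (4 * D * r powr (\<beta> / \<tau>))"
    if r: "0 < r" "r \<le> R" for r
  proof (rule esssup_I[OF holder_deviation_measurable], rule AE_I2)
    fix y assume "y \<in> space (lebesgue_on (ball x r))"
    then have y: "\<bar>y - x\<bar> < r"
      by (simp add: space_restrict_space dist_real_def)
    note dev' = dev[OF r y]
    show "ereal \<bar>?f y - poly P y\<bar> \<le> ereal (4 * D * r powr (\<beta> / \<tau>))"
    proof (cases "\<beta> / \<tau> > 1")
      case True
      then have "\<bar>?f y - poly P y\<bar> = \<bar>D * (y - x) - (?f y - ?f x)\<bar>"
        by (simp add: P_def algebra_simps)
      also have "\<dots> \<le> 4 * D * r powr (\<beta> / \<tau>)"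
      proof -
        have "0 \<le> D * r powr (\<beta> / \<tau>)"
          using \<open>D > 0\<close> by simp
        then show ?thesis
          using dev' by linarith
      qed
      finally show ?thesis
        by simp
    next
      case False
      then have "\<bar>?f y - poly P y\<bar> \<le> \<bar>D * (y - x) - (?f y - ?f x)\<bar> + \<bar>D * (y - x)\<bar>"
        by (simp add: P_def)
      also have "\<bar>D * (y - x)\<bar> \<le> D * r powr (\<beta> / \<tau>)"
      proof -
        have "r powr 1 \<le> r powr (\<beta> / \<tau>)"
          using r R False by (intro powr_mono') auto
        then show ?thesis
          using y r \<open>D > 0\<close> by (auto simp: abs_mult intro!: mult_left_mono)
      qed
      finally show ?thesis
        using dev' by simp
    qed
  qed
  ultimately show ?thesis
    unfolding pointwise_holder_def using R(1) \<open>D > 0\<close>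
    by (intro CollectI exI[of _ "4 * D"] exI[of _ R] exI[of _ P] conjI) auto
qed

lemma lower_holder_exponent_le:
  assumes "\<beta> > 1" "\<tau> > 0" "x \<in> dyadic_approximable \<tau>"
  shows "lower_holder_exponent (sawtooth_series \<beta>) x \<le> ereal (\<beta> / \<tau>)"
  unfolding lower_holder_exponent_def
  by (rule Sup_least) (use pointwise_holder_exponent_le[OF assms(1,2) _ assms(3)] assms(2) in
      \<open>auto simp: le_divide_eq\<close>)

lemma lower_holder_exponent_ge:
  assumes "\<beta> > 1" "\<tau> > 0" "x \<notin> dyadic_approximable \<tau>"
  shows "ereal (\<beta> / \<tau>) \<le> lower_holder_exponent (sawtooth_series \<beta>) x"
  unfolding lower_holder_exponent_def
  by (rule Sup_upper) (use pointwise_holder_sawtooth_series[OF assms] assms in auto)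

text \<open>The supremum of an empty set would be -\<infinity>. Local boundedness puts \<alpha> = 0,
  with the zero polynomial, into the set.\<close>

lemma lower_holder_exponent_nonneg:
  assumes "\<beta> > 1"
  shows "0 \<le> lower_holder_exponent (sawtooth_series \<beta>) x"
proof -
  define C where "C = \<bar>sawtooth_series \<beta> x\<bar> + 4 * sawtooth_slope \<beta>"
  have "C > 0"
    unfolding C_def using sawtooth_slope_pos[OF assms] by simp
  have bound: "\<bar>sawtooth_series \<beta> y\<bar> \<le> C" if "\<bar>y - x\<bar> < 1" for y
  proof -
    have "\<bar>sawtooth_slope \<beta> * (y - x)\<bar> \<le> sawtooth_slope \<beta> * 1"
      unfolding abs_mult using that sawtooth_slope_pos[OF assms] by (intro mult_mono) auto
    then show ?thesis
      unfolding C_def using sawtooth_series_linear_approx[OF assms _ that, of 0] by simp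
  qed
  have "esssup (lebesgue_on (ball x r)) (\<lambda>y. ereal \<bar>sawtooth_series \<beta> y - poly 0 y\<bar>) \<le> ereal (C * r powr 0)"
    if "0 < r" "r \<le> 1" for r
    by (rule esssup_I[OF holder_deviation_measurable], rule AE_I2)
       (use that bound in \<open>auto simp: space_restrict_space dist_real_def\<close>)
  then have "sawtooth_series \<beta> \<in> pointwise_holder 0 x"
    unfolding pointwise_holder_def using \<open>C > 0\<close>
    by (intro CollectI exI[of _ C] exI[of _ 1] exI[of _ 0] conjI) auto
  then show ?thesis
    unfolding lower_holder_exponent_def by (intro Sup_upper) (auto simp: zero_ereal_def)
qed

section \<open>Hausdorff measure\<close>

text \<open>For s > 0 small cost implies small diameters: in a cover of total cost at most
  \<open>d powr s\<close> every set has diameter at most d.\<close>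

lemma hausdorff_measure_zeroI:
  fixes A :: "'a::metric_space set"
  assumes "s > 0"
    and "\<And>e::real. e > 0 \<Longrightarrow> \<exists>U. A \<subseteq> (\<Union>i. U i) \<and> (\<forall>i. bounded (U i)) \<and> (\<Sum>i. hausdorff_cost s (U i)) \<le> ennreal e"
  shows "hausdorff_measure s A = 0"
proof -
  have "hausdorff_premeasure s d A \<le> 0 + ennreal e" if "d > 0" "e > 0" for d e
  proof -
    define e' where "e' = min e (d powr s)"
    have "e' > 0"
      using that by (simp add: e'_def)
    from assms(2)[OF this] obtain U where U': "A \<subseteq> (\<Union>i. U i) \<and> (\<forall>i. bounded (U i)) \<and>
        (\<Sum>i. hausdorff_cost s (U i)) \<le> ennreal e'" ..
    then have U: "A \<subseteq> (\<Union>i. U i)" "bounded (U i)" "(\<Sum>i. hausdorff_cost s (U i)) \<le> ennreal e'" for i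
      by simp_all
    have "diameter (U i) \<le> d" for i
    proof (cases "U i = {}")
      case False
      have "hausdorff_cost s (U i) \<le> (\<Sum>i. hausdorff_cost s (U i))"
        using sum_le_suminf[of "\<lambda>i. hausdorff_cost s (U i)" "{i}"] by simp
      also have "\<dots> \<le> ennreal e'"
        by (rule U)
      finally have "diameter (U i) powr s \<le> d powr s"
        using False \<open>s > 0\<close> \<open>e' > 0\<close> by (simp add: hausdorff_cost_def ennreal_le_iff e'_def)
      then show ?thesis
        using \<open>s > 0\<close> \<open>d > 0\<close> powr_less_mono2[of s d "diameter (U i)"] by linarith
    qed (use that in auto)
    then have "U \<in> hausdorff_covers d A"
      unfolding hausdorff_covers_def using U by auto
    then have "hausdorff_premeasure s d A \<le> (\<Sum>i. hausdorff_cost s (U i))"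
      unfolding hausdorff_premeasure_def by (rule INF_lower)
    also have "\<dots> \<le> ennreal e'"
      by (rule U)
    also have "\<dots> \<le> ennreal e"
      by (rule ennreal_leI) (simp add: e'_def)
    finally show ?thesis
      by simp
  qed
  then have "hausdorff_premeasure s d A \<le> 0" if "d > 0" for d
    by (rule ennreal_le_epsilon) (use that in simp)
  then have "hausdorff_measure s A \<le> 0"
    unfolding hausdorff_measure_def by (intro SUP_least) simp
  then show ?thesis
    by simp
qed

lemma hausdorff_measure_zeroD:
  assumes "hausdorff_measure s A = 0" "d > 0" "e > (0::real)"
  obtains U where "A \<subseteq> (\<Union>i. U i)" "\<And>i. bounded (U i)" "\<And>i. diameter (U i) \<le> d"
    "(\<Sum>i. hausdorff_cost s (U i)) < ennreal e"
proof -
  have "hausdorff_premeasure s d A \<le> hausdorff_measure s A"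
    unfolding hausdorff_measure_def using assms(2) by (intro SUP_upper) auto
  also have "\<dots> < ennreal e"
    using assms by simp
  finally obtain U where "U \<in> hausdorff_covers d A" "(\<Sum>i. hausdorff_cost s (U i)) < ennreal e"
    unfolding hausdorff_premeasure_def INF_less_iff by (elim bexE)
  then show ?thesis
    by (intro that[of U]) (simp_all add: hausdorff_covers_def)
qed

lemma hausdorff_measure_zero_subset:
  assumes "hausdorff_measure s A = 0" "B \<subseteq> A"
  shows "hausdorff_measure s B = 0"
proof -
  have "hausdorff_premeasure s d B \<le> hausdorff_premeasure s d A" for d
    unfolding hausdorff_premeasure_def
  proof (rule INF_superset_mono)
    show "hausdorff_covers d A \<subseteq> hausdorff_covers d B"
      unfolding hausdorff_covers_def using assms(2) by (auto intro: subset_trans)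
  qed simp
  then have "hausdorff_measure s B \<le> hausdorff_measure s A"
    unfolding hausdorff_measure_def by (intro SUP_mono') simp
  then show ?thesis
    using assms(1) by simp
qed

lemma hausdorff_measure_zero_UN:
  fixes A :: "nat \<Rightarrow> 'a::metric_space set"
  assumes "s > 0" "\<And>n. hausdorff_measure s (A n) = 0"
  shows "hausdorff_measure s (\<Union>n. A n) = 0"
proof (rule hausdorff_measure_zeroI[OF assms(1)])
  fix e :: real assume "e > 0"
  have "\<forall>n. \<exists>U. A n \<subseteq> (\<Union>i. U i) \<and> (\<forall>i. bounded (U i)) \<and>
      (\<Sum>i. hausdorff_cost s (U i)) < ennreal (e * (1/2) ^ Suc n)"
  proof
    fix n
    have "0 < e * (1/2) ^ Suc n"
      using \<open>e > 0\<close> by simp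
    then show "\<exists>U. A n \<subseteq> (\<Union>i. U i) \<and> (\<forall>i. bounded (U i)) \<and>
      (\<Sum>i. hausdorff_cost s (U i)) < ennreal (e * (1/2) ^ Suc n)"
      by (rule hausdorff_measure_zeroD[OF assms(2) zero_less_one]) blast
  qed
  from choice[OF this] obtain U where U': "\<forall>n. A n \<subseteq> (\<Union>i. U n i) \<and> (\<forall>i. bounded (U n i)) \<and>
      (\<Sum>i. hausdorff_cost s (U n i)) < ennreal (e * (1/2) ^ Suc n)" ..
  have U: "A n \<subseteq> (\<Union>i. U n i)" "bounded (U n i)"
      "(\<Sum>i. hausdorff_cost s (U n i)) < ennreal (e * (1/2) ^ Suc n)" for n i
    using U' by simp_all
  let ?V = "\<lambda>j. case_prod U (prod_decode j)"
  have "(\<Union>n. A n) \<subseteq> (\<Union>j. ?V j)"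
  proof clarsimp
    fix x n assume "x \<in> A n"
    then obtain i where "x \<in> U n i"
      using U(1) by blast
    then show "\<exists>j. x \<in> ?V j"
      by (intro exI[of _ "prod_encode (n, i)"]) simp
  qed
  moreover have "\<forall>j. bounded (?V j)"
    using U(2) by (auto split: prod.split)
  moreover have "(\<Sum>j. hausdorff_cost s (?V j)) \<le> ennreal e"
  proof -
    have "(\<Sum>j. hausdorff_cost s (?V j)) = (\<Sum>n. \<Sum>i. hausdorff_cost s (U n i))"
      by (rule suminf_ennreal_2dimen[of _ "\<lambda>p. hausdorff_cost s (case_prod U p)"]) simp
    moreover have "(\<Sum>n. \<Sum>i. hausdorff_cost s (U n i)) \<le> (\<Sum>n. ennreal (e * (1/2) ^ Suc n))"
      by (intro suminf_le less_imp_le[OF U(3)]) auto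
    moreover have "(\<Sum>n. ennreal (e * (1/2) ^ Suc n)) = ennreal e"
    proof -
      have "(\<lambda>n. e * (1/2) ^ Suc n) sums (e * 1)"
        by (intro sums_mult power_half_series)
      then show ?thesis
        using \<open>e > 0\<close> by (intro suminf_ennreal_eq) auto
    qed
    ultimately show ?thesis
      by simp
  qed
  ultimately show "\<exists>V. (\<Union>n. A n) \<subseteq> (\<Union>i. V i) \<and> (\<forall>i. bounded (V i)) \<and> (\<Sum>i. hausdorff_cost s (V i)) \<le> ennreal e"
    by (intro exI[of _ ?V]) blast
qed

section \<open>Dimension of the well approximable points\<close>

lemma hausdorff_measure_dyadic_approximable_unit:
  fixes m :: int
  assumes "\<tau> > 0" "s * \<tau> > 1"
  shows "hausdorff_measure s (dyadic_approximable \<tau> \<inter> {of_int m..of_int m + 1}) = 0"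
proof -
  have "s > 0"
    using assms zero_less_mult_pos2[of s \<tau>] by simp
  define c where "c = 1 - s * \<tau>"
  have "c < 0"
    using assms by (simp add: c_def)
  show ?thesis
  proof (rule hausdorff_measure_zeroI[OF \<open>s > 0\<close>])
    fix e :: real assume "e > 0"
    \<comment> \<open>Level l needs at most \<open>2 * 2 ^ l\<close> balls of radius
      \<open>2 powr (- l * \<tau>)\<close>, each of cost
      \<open>(2 * 2 powr (- l * \<tau>)) powr s\<close>; the product is \<open>?b l\<close>. Since
      members are close to grids of arbitrarily high level, the balls of a tail of the series still
      cover.\<close>
    let ?b = "\<lambda>l. 2 * 2 powr s * 2 powr (real l * c)"
    have sb: "summable ?b"
      by (intro summable_mult summable_powr_mult \<open>c < 0\<close>)
    obtain N where N: "norm (\<Sum>i. ?b (i + N)) < e"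
      using suminf_exist_split[OF \<open>e > 0\<close> sb] by blast
    define U where "U l i = (if i \<le> 2 ^ (l + N)
        then cball ((of_int m * 2 ^ (l + N) + real i) / 2 ^ (l + N)) (2 powr (- real (l + N) * \<tau>)) else {})"
      for l i :: nat
    let ?V = "\<lambda>j. case_prod U (prod_decode j)"
    have "dyadic_approximable \<tau> \<inter> {of_int m..of_int m + 1} \<subseteq> (\<Union>j. ?V j)"
    proof
      fix x assume x: "x \<in> dyadic_approximable \<tau> \<inter> {of_int m..of_int m + 1}"
      then obtain n where "n \<ge> N" "dyadic_dist n x \<le> 2 powr (- real n * \<tau>)"
        unfolding dyadic_approximable_def frequently_sequentially by blast
      then obtain l where l: "dyadic_dist (l + N) x \<le> 2 powr (- real (l + N) * \<tau>)"
        by (metis le_iff_add add.commute)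
      define k where "k = round (2 ^ (l + N) * x)"
      have "2 ^ (l + N) * of_int m \<le> 2 ^ (l + N) * x" "2 ^ (l + N) * x \<le> 2 ^ (l + N) * (of_int m + 1)"
        using x by (auto intro!: mult_left_mono)
      \<comment> \<open>Rounding is monotone and fixes the scaled end points, so the nearest grid
        point stays in the unit interval and is one of the centres.\<close>
      then have "round (2 ^ (l + N) * of_int m :: real) \<le> k" "k \<le> round (2 ^ (l + N) * (of_int m + 1) :: real)"
        unfolding k_def by (auto intro: round_mono)
      moreover have "round (2 ^ (l + N) * of_int m :: real) = 2 ^ (l + N) * m"
        using round_of_int[of "2 ^ (l + N) * m"] by simp
      moreover have "round (2 ^ (l + N) * (of_int m + 1) :: real) = 2 ^ (l + N) * (m + 1)"
        using round_of_int[of "2 ^ (l + N) * (m + 1)"] by simp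
      ultimately have k: "2 ^ (l + N) * m \<le> k" "k \<le> 2 ^ (l + N) * m + 2 ^ (l + N)"
        by (auto simp: algebra_simps)
      define i where "i = nat (k - 2 ^ (l + N) * m)"
      have i: "k = m * 2 ^ (l + N) + int i"
        using k by (simp add: i_def)
      then have "i \<le> 2 ^ (l + N)"
        using k unfolding i_def by (simp add: nat_le_iff)
      moreover have "\<bar>x - (of_int m * 2 ^ (l + N) + real i) / 2 ^ (l + N)\<bar> = dyadic_dist (l + N) x"
        unfolding dyadic_dist_eq k_def[symmetric] i by simp
      ultimately have "x \<in> U l i"
        using l unfolding U_def by (simp add: dist_real_def abs_minus_commute)
      then show "x \<in> (\<Union>j. ?V j)"
        by (intro UN_I[of "prod_encode (l, i)"]) auto
    qed
    moreover have "\<forall>j. bounded (?V j)"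
      by (auto simp: U_def split: prod.split)
    moreover have "(\<Sum>j. hausdorff_cost s (?V j)) \<le> ennreal e"
    proof -
      have "(\<Sum>j. hausdorff_cost s (?V j)) = (\<Sum>l. \<Sum>i. hausdorff_cost s (U l i))"
        by (rule suminf_ennreal_2dimen[of _ "\<lambda>p. hausdorff_cost s (case_prod U p)"]) simp
      also have "\<dots> \<le> (\<Sum>l. ennreal (?b (l + N)))"
      proof (intro suminf_le)
        fix l
        have "(\<Sum>i. hausdorff_cost s (U l i)) = (\<Sum>i\<le>2 ^ (l + N). hausdorff_cost s (U l i))"
          by (rule suminf_finite) (auto simp: U_def hausdorff_cost_def)
        also have "\<dots> = (\<Sum>i\<le>(2::nat) ^ (l + N). ennreal ((2 * 2 powr (- real (l + N) * \<tau>)) powr s))"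
          using \<open>s > 0\<close> by (intro sum.cong) (auto simp: U_def hausdorff_cost_def)
        also have "\<dots> = ennreal ((2 ^ (l + N) + 1) * (2 * 2 powr (- real (l + N) * \<tau>)) powr s)"
          by (subst sum_ennreal) (simp_all add: algebra_simps)
        also have "\<dots> \<le> ennreal (?b (l + N))"
        proof (rule ennreal_leI)
          have "(2 ^ (l + N) + 1) * (2 * 2 powr (- real (l + N) * \<tau>)) powr s
             \<le> (2 * 2 ^ (l + N)) * (2 * 2 powr (- real (l + N) * \<tau>)) powr s"
            by (intro mult_right_mono) auto
          also have "\<dots> = 2 * (2 powr real (l + N)) * (2 powr s * 2 powr (- real (l + N) * \<tau> * s))"
            by (simp add: powr_mult powr_powr powr_realpow del: of_nat_add)
          also have "\<dots> = ?b (l + N)"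
            by (simp add: c_def algebra_simps flip: powr_add)
          finally show "(2 ^ (l + N) + 1) * (2 * 2 powr (- real (l + N) * \<tau>)) powr s \<le> ?b (l + N)" .
        qed
        finally show "(\<Sum>i. hausdorff_cost s (U l i)) \<le> ennreal (?b (l + N))" .
      qed auto
      also have "\<dots> = ennreal (\<Sum>l. ?b (l + N))"
        by (rule suminf_ennreal2[OF _ summable_ignore_initial_segment[OF sb]]) simp
      also have "\<dots> \<le> ennreal e"
        using N by (intro ennreal_leI) simp
      finally show ?thesis .
    qed
    ultimately show "\<exists>V. dyadic_approximable \<tau> \<inter> {of_int m..of_int m + 1} \<subseteq> (\<Union>i. V i) \<and> (\<forall>i. bounded (V i)) \<and>
        (\<Sum>i. hausdorff_cost s (V i)) \<le> ennreal e"
      by (intro exI[of _ ?V]) blast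
  qed
qed

lemma hausdorff_measure_dyadic_approximable:
  assumes "\<tau> > 0" "s * \<tau> > 1"
  shows "hausdorff_measure s (dyadic_approximable \<tau>) = 0"
proof -
  have "s > 0"
    using assms zero_less_mult_pos2[of s \<tau>] by simp
  let ?A = "\<lambda>n. dyadic_approximable \<tau> \<inter> {of_int (int_decode n)..of_int (int_decode n) + 1}"
  have "dyadic_approximable \<tau> \<subseteq> (\<Union>n. ?A n)"
  proof
    fix x assume "x \<in> dyadic_approximable \<tau>"
    then have "x \<in> ?A (int_encode \<lfloor>x\<rfloor>)"
      by simp
    then show "x \<in> (\<Union>n. ?A n)"
      by blast
  qed
  moreover have "hausdorff_measure s (\<Union>n. ?A n) = 0"
    by (rule hausdorff_measure_zero_UN[OF \<open>s > 0\<close> hausdorff_measure_dyadic_approximable_unit[OF assms]])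
  ultimately show ?thesis
    by (rule hausdorff_measure_zero_subset[rotated])
qed

text \<open>The cover of \<open>E\<close> pulls back along \<open>F\<close> to a cover of the unit interval, whose Lebesgue
  measure is \<open>1\<close>; no mass distribution on \<open>E\<close> has to be constructed.\<close>

lemma hausdorff_measure_nonzeroI:
  fixes F :: "real \<Rightarrow> 'a::metric_space"
  assumes F: "\<And>t. t \<in> {0..<1} \<Longrightarrow> F t \<in> E" and "0 \<le> s'" "s' \<le> s"
    and hold: "\<And>t u. t \<in> {0..<1} \<Longrightarrow> u \<in> {0..<1} \<Longrightarrow> \<bar>t - u\<bar> \<le> C * dist (F t) (F u) powr s"
  shows "hausdorff_measure s' E \<noteq> 0"
proof
  assume zero: "hausdorff_measure s' E = 0"
  define C' where "C' = max C 1"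
  have C': "C' > 0" "C \<le> C'"
    by (auto simp: C'_def)
  \<comment> \<open>The budget gives the pulled back cover measure at most
    \<open>2 * C' * (1 / (4 * C')) = 1 / 2\<close>. Diameters at most 1 permit lowering the exponent
    from s to s'.\<close>
  obtain U where U: "E \<subseteq> (\<Union>i. U i)" "\<And>i. bounded (U i)" "\<And>i. diameter (U i) \<le> 1"
    and small: "(\<Sum>i. hausdorff_cost s' (U i)) < ennreal (1 / (4 * C'))"
    by (rule hausdorff_measure_zeroD[OF zero zero_less_one, of "1 / (4 * C')"]) (use C' in auto)
  \<comment> \<open>The preimages need not be measurable; a closed interval around one of their
    points replaces them.\<close>
  have "\<exists>B. {t\<in>{0..<1}. F t \<in> U i} \<subseteq> B \<and> B \<in> sets lborel \<and> emeasure lborel B \<le> ennreal (2 * C') * hausdorff_cost s' (U i)" for i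
  proof (cases "{t\<in>{0..<1}. F t \<in> U i} = {}")
    case True
    then show ?thesis
      by (intro exI[of _ "{}"]) auto
  next
    case False
    then obtain t where t: "t \<in> {0..<1}" "F t \<in> U i"
      by blast
    \<comment> \<open>For s' = 0 a nonempty set costs 1, whereas
      \<open>0 powr 0 = 0\<close>.\<close>
    define \<rho> where "\<rho> = C' * (if s' = 0 then 1 else diameter (U i) powr s')"
    have "\<rho> \<ge> 0"
      using C' by (simp add: \<rho>_def)
    have "\<bar>t - u\<bar> \<le> \<rho>" if u: "u \<in> {0..<1}" "F u \<in> U i" for u
    proof -
      have d: "dist (F t) (F u) \<le> diameter (U i)"
        using diameter_bounded_bound[OF U(2)] t u by blast
      have "\<bar>t - u\<bar> \<le> C' * dist (F t) (F u) powr s"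
        by (rule order_trans[OF hold[OF t(1) u(1)]]) (use C' in \<open>auto intro: mult_right_mono\<close>)
      also have "dist (F t) (F u) powr s \<le> (if s' = 0 then 1 else diameter (U i) powr s')"
      proof (cases "s' = 0")
        case True
        have "dist (F t) (F u) powr s \<le> 1"
          using d U(3)[of i] assms by (intro powr_le1) auto
        then show ?thesis
          using True by simp
      next
        case False
        have "dist (F t) (F u) powr s \<le> dist (F t) (F u) powr s'"
          using d U(3)[of i] assms by (intro powr_mono') auto
        also have "\<dots> \<le> diameter (U i) powr s'"
          using d assms by (intro powr_mono2) auto
        finally show ?thesis
          using False by simp
      qed
      finally show ?thesis
        using C' by (simp add: \<rho>_def)
    qed
    then have "{t\<in>{0..<1}. F t \<in> U i} \<subseteq> {t - \<rho>..t + \<rho>}"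
      by (force simp: abs_le_iff)
    moreover have "emeasure lborel {t - \<rho>..t + \<rho>} \<le> ennreal (2 * C') * hausdorff_cost s' (U i)"
    proof -
      have "emeasure lborel {t - \<rho>..t + \<rho>} = ennreal (2 * \<rho>)"
        using \<open>\<rho> \<ge> 0\<close> by simp
      also have "\<dots> = ennreal (2 * C') * hausdorff_cost s' (U i)"
        using t(2) C' by (auto simp: \<rho>_def hausdorff_cost_def mult_ac ennreal_mult)
      finally show ?thesis
        by simp
    qed
    ultimately show ?thesis
      by (intro exI[of _ "{t - \<rho>..t + \<rho>}"]) auto
  qed
  then have "\<forall>i. \<exists>B. {t\<in>{0..<1}. F t \<in> U i} \<subseteq> B \<and> B \<in> sets lborel \<and>
      emeasure lborel B \<le> ennreal (2 * C') * hausdorff_cost s' (U i)"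
    by blast
  from choice[OF this] obtain B where B': "\<forall>i. {t\<in>{0..<1}. F t \<in> U i} \<subseteq> B i \<and> B i \<in> sets lborel \<and>
      emeasure lborel (B i) \<le> ennreal (2 * C') * hausdorff_cost s' (U i)" ..
  have B: "{t\<in>{0..<1}. F t \<in> U i} \<subseteq> B i" "B i \<in> sets lborel"
      "emeasure lborel (B i) \<le> ennreal (2 * C') * hausdorff_cost s' (U i)" for i
    using B' by simp_all
  have "{0..<1} \<subseteq> (\<Union>i. B i)"
  proof
    fix t :: real assume t: "t \<in> {0..<1}"
    then obtain i where "F t \<in> U i"
      using F U(1) by blast
    then show "t \<in> (\<Union>i. B i)"
      using B(1)[of i] t by blast
  qed
  then have "emeasure lborel {0..<1::real} \<le> emeasure lborel (\<Union>i. B i)"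
    using B(2) by (intro emeasure_mono) auto
  also have "\<dots> \<le> (\<Sum>i. emeasure lborel (B i))"
    using B(2) by (intro emeasure_subadditive_countably) auto
  also have "\<dots> \<le> (\<Sum>i. ennreal (2 * C') * hausdorff_cost s' (U i))"
    by (intro suminf_le B) auto
  also have "\<dots> = ennreal (2 * C') * (\<Sum>i. hausdorff_cost s' (U i))"
    by simp
  also have "\<dots> \<le> ennreal (2 * C') * ennreal (1 / (4 * C'))"
    using small by (intro mult_left_mono) auto
  also have "\<dots> = ennreal (1 / 2)"
    using C' by (subst ennreal_mult[symmetric]) simp_all
  finally have "emeasure lborel {0..<1::real} \<le> ennreal (1 / 2)" .
  then have "ennreal 1 \<le> ennreal (1 / 2)"
    by (subst (asm) emeasure_lborel_Ico) simp_all
  then have "(1::real) \<le> 1 / 2"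
    by (rule ennreal_le_iff[THEN iffD1, rotated]) simp
  then show False
    by simp
qed

section \<open>Binary expansions with free and prescribed digits\<close>

definition binary_real :: "(nat \<Rightarrow> int) \<Rightarrow> real" where
  "binary_real e = (\<Sum>i. of_int (e i) / 2 ^ i)"

fun binary_prefix :: "(nat \<Rightarrow> int) \<Rightarrow> nat \<Rightarrow> int" where
  "binary_prefix e 0 = e 0"
| "binary_prefix e (Suc n) = 2 * binary_prefix e n + e (Suc n)"

text \<open>The part of \<open>2 ^ n * binary_real e\<close> after the binary point. Unlike a
  fractional part it can be 1, namely when all later digits are 1.\<close>

definition binary_tail :: "(nat \<Rightarrow> int) \<Rightarrow> nat \<Rightarrow> real" where
  "binary_tail e n = 2 ^ n * binary_real e - of_int (binary_prefix e n)"

lemma binary_tail_Suc: "binary_tail e n = (of_int (e (Suc n)) + binary_tail e (Suc n)) / 2"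
  by (simp add: binary_tail_def)

lemma binary_prefix_eq_sum: "of_int (binary_prefix e n) = (2 ^ n * (\<Sum>i<Suc n. of_int (e i) / 2 ^ i) :: real)"
proof (induction n)
  case (Suc n)
  have "real_of_int (binary_prefix e (Suc n)) = 2 * of_int (binary_prefix e n) + of_int (e (Suc n))"
    by simp
  also have "\<dots> = 2 ^ Suc n * (\<Sum>i<Suc n. of_int (e i) / 2 ^ i) + 2 ^ Suc n * (of_int (e (Suc n)) / 2 ^ Suc n)"
    by (simp only: Suc) simp
  also have "\<dots> = 2 ^ Suc n * (\<Sum>i<Suc (Suc n). of_int (e i) / 2 ^ i)"
    by (simp add: distrib_left)
  finally show ?case .
qed simp

lemma binary_tail_bounds:
  assumes "\<And>i. e i \<in> {0, 1}"
  shows "0 \<le> binary_tail e n" "binary_tail e n \<le> 1"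
proof -
  have e: "0 \<le> (of_int (e i) :: real)" "of_int (e i) \<le> (1::real)" for i
    using assms[of i] by auto
  have geo: "(\<lambda>i. (1/2) ^ Suc i) sums (1::real)"
    by (rule power_half_series)
  have "summable (\<lambda>i. of_int (e i) / 2 ^ i :: real)"
    by (rule summable_comparison_test'[OF summable_mult[OF sums_summable[OF geo], of 2]])
       (use e in \<open>simp add: power_divide divide_right_mono\<close>)
  then have s: "(\<lambda>i. of_int (e i) / 2 ^ i :: real) sums binary_real e"
    unfolding binary_real_def by (rule summable_sums)
  have "(\<lambda>i. 2 ^ n * (of_int (e (i + Suc n)) / 2 ^ (i + Suc n) :: real)) sums
      (2 ^ n * (binary_real e - (\<Sum>i<Suc n. of_int (e i) / 2 ^ i)))"
    by (intro sums_mult sums_split_initial_segment[OF s])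
  also have "(\<lambda>i. 2 ^ n * (of_int (e (i + Suc n)) / 2 ^ (i + Suc n) :: real)) =
      (\<lambda>i. of_int (e (i + Suc n)) * (1/2) ^ Suc i)"
    by (simp add: power_add power_divide fun_eq_iff)
  also have "2 ^ n * (binary_real e - (\<Sum>i<Suc n. of_int (e i) / 2 ^ i)) = binary_tail e n"
    unfolding binary_tail_def binary_prefix_eq_sum by (simp only: right_diff_distrib)
  finally have t: "(\<lambda>i. of_int (e (i + Suc n)) * (1/2) ^ Suc i) sums binary_tail e n" .
  show "0 \<le> binary_tail e n"
    by (rule sums_le[OF _ sums_zero t]) (use e in simp)
  have "of_int (e (i + Suc n)) * (1/2) ^ Suc i \<le> (1::real) * (1/2) ^ Suc i" for i :: nat
    by (rule mult_right_mono) (use e in auto)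
  then show "binary_tail e n \<le> 1"
    by (intro sums_le[OF _ t geo]) simp
qed

text \<open>Induction on the window length: the next digit either is the required one and
  contributes \<open>1 / 2\<close>, or the bound for the shorter window is halved. For w = 0 the
  window is empty.\<close>

lemma binary_tail_ge:
  assumes "\<And>i. e i \<in> {0, 1}"
  shows "n < i \<Longrightarrow> i \<le> n + w \<Longrightarrow> e i = 1 \<Longrightarrow> 1 / 2 ^ w \<le> binary_tail e n"
proof (induction w arbitrary: n)
  case (Suc w)
  show ?case
  proof (cases "i = Suc n")
    case True
    define q :: real where "q = 1 / 2 ^ w"
    have "q \<le> 1"
      by (simp add: q_def field_simps)
    moreover have "binary_tail e n = (1 + binary_tail e (Suc n)) / 2"
      using True Suc.prems binary_tail_Suc[of e n] by simp
    ultimately have "q / 2 \<le> binary_tail e n"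
      using binary_tail_bounds(1)[of e "Suc n", OF assms] by (simp add: add_increasing2)
    then show ?thesis
      by (simp add: q_def)
  next
    case False
    then have "1 / 2 ^ w \<le> binary_tail e (Suc n)"
      using Suc.prems by (intro Suc.IH) auto
    moreover have "binary_tail e (Suc n) / 2 \<le> binary_tail e n"
      using assms[of "Suc n"] binary_tail_Suc[of e n] by auto
    ultimately show ?thesis
      by simp
  qed
qed simp

lemma binary_tail_le:
  assumes "\<And>i. e i \<in> {0, 1}"
  shows "n < i \<Longrightarrow> i \<le> n + w \<Longrightarrow> e i = 0 \<Longrightarrow> binary_tail e n \<le> 1 - 1 / 2 ^ w"
proof (induction w arbitrary: n)
  case (Suc w)
  show ?case
  proof (cases "i = Suc n")
    case True
    define q :: real where "q = 1 / 2 ^ w"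
    have "q \<le> 1"
      by (simp add: q_def field_simps)
    moreover have "binary_tail e n = binary_tail e (Suc n) / 2"
      using True Suc.prems binary_tail_Suc[of e n] by simp
    ultimately have "binary_tail e n \<le> 1 - q / 2"
      using binary_tail_bounds(2)[of e "Suc n", OF assms] by linarith
    then show ?thesis
      by (simp add: q_def)
  next
    case False
    then have "binary_tail e (Suc n) \<le> 1 - 1 / 2 ^ w"
      using Suc.prems by (intro Suc.IH) auto
    moreover have "binary_tail e n \<le> (1 + binary_tail e (Suc n)) / 2"
      using assms[of "Suc n"] binary_tail_Suc[of e n] by auto
    ultimately show ?thesis
      by simp
  qed
qed simp

lemma binary_tail_le_run:
  assumes "\<And>i. e i \<in> {0, 1}"
  shows "(\<And>i. n < i \<Longrightarrow> i \<le> n + w \<Longrightarrow> e i = 0) \<Longrightarrow> binary_tail e n \<le> 1 / 2 ^ w"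
proof (induction w arbitrary: n)
  case 0
  show ?case
    using binary_tail_bounds(2)[of e n, OF assms] by simp
next
  case (Suc w)
  then have "binary_tail e (Suc n) \<le> 1 / 2 ^ w" "e (Suc n) = 0"
    by auto
  then show ?case
    by (subst binary_tail_Suc) simp
qed

text \<open>The one keeps the tail away from 0 and the zero keeps it away from 1, so
  \<open>2 ^ n * binary_real e\<close> has distance at least \<open>1 / 2 ^ w\<close> from the
  integers on both sides.\<close>

lemma dyadic_dist_binary_ge:
  assumes "\<And>i. e i \<in> {0, 1}" "n < i" "i \<le> n + w" "e i = 1" "n < j" "j \<le> n + w" "e j = 0"
  shows "1 / 2 ^ (n + w) \<le> dyadic_dist n (binary_real e)"
proof -
  have t: "1 / 2 ^ w \<le> binary_tail e n" "binary_tail e n \<le> 1 - 1 / 2 ^ w"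
    using binary_tail_ge[of e, OF assms(1-4)] binary_tail_le[of e, OF assms(1,5-7)] by auto
  define k where "k = round (2 ^ n * binary_real e)"
  have x: "2 ^ n * binary_real e = of_int (binary_prefix e n) + binary_tail e n"
    by (simp add: binary_tail_def)
  have "1 / 2 ^ w \<le> \<bar>2 ^ n * binary_real e - of_int k\<bar>"
  proof (cases "k \<le> binary_prefix e n")
    case True
    then have "real_of_int k \<le> of_int (binary_prefix e n)"
      by simp
    then show ?thesis
      using x t by linarith
  next
    case False
    then have "real_of_int (binary_prefix e n + 1) \<le> of_int k"
      unfolding of_int_le_iff by simp
    then show ?thesis
      using x t by simp
  qed
  then have "1 / 2 ^ w / 2 ^ n \<le> dyadic_dist n (binary_real e)"
    unfolding dyadic_dist_def k_def[symmetric] by (rule divide_right_mono) simp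
  then show ?thesis
    by (simp add: power_add mult.commute)
qed

lemma dyadic_dist_binary_le:
  assumes "\<And>i. e i \<in> {0, 1}" "\<And>i. n < i \<Longrightarrow> i \<le> n + w \<Longrightarrow> e i = 0"
  shows "dyadic_dist n (binary_real e) \<le> 1 / 2 ^ (n + w)"
proof -
  have "binary_real e - of_int (binary_prefix e n) / 2 ^ n = binary_tail e n / 2 ^ n"
    by (simp add: binary_tail_def field_simps)
  then have "dyadic_dist n (binary_real e) \<le> binary_tail e n / 2 ^ n"
    using dyadic_dist_le[of n "binary_real e" "binary_prefix e n"] binary_tail_bounds(1)[of e n, OF assms(1)]
    by simp
  also have "\<dots> \<le> 1 / 2 ^ w / 2 ^ n"
    by (intro divide_right_mono binary_tail_le_run assms) auto
  finally show ?thesis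
    by (simp add: power_add mult.commute)
qed

text \<open>For i in S, \<open>card (S \<inter> {..i})\<close> is the rank of i in S, and
  \<open>\<lfloor>2 ^ k * t\<rfloor> mod 2\<close> is the k-th binary digit of t. Hence S carries
  the digits of t in order; outside S, T marks the prescribed ones.\<close>

definition interleaved_digit :: "nat set \<Rightarrow> nat set \<Rightarrow> real \<Rightarrow> nat \<Rightarrow> int" where
  "interleaved_digit S T t i =
     (if i \<in> S then \<lfloor>2 ^ card (S \<inter> {..i}) * t\<rfloor> mod 2 else if i \<in> T then 1 else 0)"

lemma interleaved_digit_bit: "interleaved_digit S T t i \<in> {0, 1}"
  by (auto simp: interleaved_digit_def)

lemma floor_double_div: "\<lfloor>2 * y\<rfloor> = 2 * \<lfloor>y :: real\<rfloor> + \<lfloor>2 * y\<rfloor> mod 2"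
proof -
  have "\<lfloor>2 * y\<rfloor> div 2 = \<lfloor>y\<rfloor>"
    using floor_divide_of_int_eq[of "\<lfloor>2 * y\<rfloor>" 2] by linarith
  then show ?thesis
    by (metis mult_div_mod_eq)
qed

text \<open>Digit by digit: a free digit doubles both differences and adds the same amount to each;
  a prescribed digit doubles only the right-hand side, which already dominates a nonnegative
  left-hand side.\<close>

lemma interleaved_prefix_diff:
  assumes "0 \<notin> S" "0 \<le> t" "t \<le> u" "u < 1"
  shows "\<lfloor>2 ^ card (S \<inter> {..n}) * u\<rfloor> - \<lfloor>2 ^ card (S \<inter> {..n}) * t\<rfloor>
     \<le> binary_prefix (interleaved_digit S T u) n - binary_prefix (interleaved_digit S T t) n"
proof (induction n)
  case 0
  have "S \<inter> {..0} = {}"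
    using assms(1) by auto
  moreover have "\<lfloor>u\<rfloor> = 0" "\<lfloor>t\<rfloor> = 0"
    using assms by (auto simp: floor_eq_iff)
  ultimately show ?case
    using assms(1) by (simp add: interleaved_digit_def)
next
  case (Suc n)
  define m where "m = card (S \<inter> {..n})"
  have mono: "\<lfloor>2 ^ m * t\<rfloor> \<le> \<lfloor>2 ^ m * u\<rfloor>"
    using assms by (intro floor_mono mult_left_mono) auto
  show ?case
  proof (cases "Suc n \<in> S")
    case True
    then have c: "card (S \<inter> {..Suc n}) = Suc m"
      by (simp add: m_def atMost_Suc Int_insert_right)
    have f: "\<lfloor>2 ^ Suc m * z\<rfloor> = 2 * \<lfloor>2 ^ m * z\<rfloor> + \<lfloor>2 ^ Suc m * z\<rfloor> mod 2" for z :: real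
      using floor_double_div[of "2 ^ m * z"] by (simp add: mult.assoc)
    show ?thesis
      using Suc True f[of t] f[of u] unfolding c m_def[symmetric]
      by (simp add: interleaved_digit_def c)
  next
    case False
    then have c: "card (S \<inter> {..Suc n}) = m"
      by (simp add: m_def atMost_Suc Int_insert_right)
    show ?thesis
      using Suc False mono unfolding c m_def[symmetric]
      by (simp add: interleaved_digit_def)
  qed
qed

text \<open>Tails lie in the unit interval, so for images closer than \<open>1 / 2 ^ n\<close> the
  prefix of u exceeds that of t by less than 2, hence by at most 1. The same then holds for the
  integers formed by the free digits, and u - t is at most two units of the last free place.\<close>

lemma interleaved_close:
  assumes "0 \<notin> S" "0 \<le> t" "t \<le> u" "u < 1"
    and "dist (binary_real (interleaved_digit S T t)) (binary_real (interleaved_digit S T u)) < 1 / 2 ^ n"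
  shows "u - t \<le> 2 / 2 ^ card (S \<inter> {..n})"
proof -
  let ?e = "interleaved_digit S T"
  define m where "m = card (S \<inter> {..n})"
  have "2 ^ n * (binary_real (?e u) - binary_real (?e t)) < 2 ^ n * (1 / 2 ^ n)"
    using assms(5) by (intro mult_strict_left_mono) (auto simp: dist_real_def)
  then have "of_int (binary_prefix (?e u) n - binary_prefix (?e t) n) < (2::real)"
    using binary_tail_bounds[of "?e u" n, OF interleaved_digit_bit]
      binary_tail_bounds[of "?e t" n, OF interleaved_digit_bit]
    unfolding binary_tail_def by (simp add: right_diff_distrib)
  then have "binary_prefix (?e u) n - binary_prefix (?e t) n < 2"
    by linarith
  then have "\<lfloor>2 ^ m * u\<rfloor> - \<lfloor>2 ^ m * t\<rfloor> \<le> 1"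
    using interleaved_prefix_diff[OF assms(1-4), of n T] by (simp add: m_def)
  then have "2 ^ m * u - 2 ^ m * t \<le> 2"
    by linarith
  then show ?thesis
    by (simp add: m_def[symmetric] field_simps)
qed

text \<open>A distance between \<open>1 / 2 ^ Suc n\<close> and \<open>1 / 2 ^ n\<close> determines
  t up to two units in a place of index at least \<open>s * n - K\<close>. Passing from n to
  \<open>Suc n\<close> costs the factor \<open>2 powr s\<close>; the maximum with 1 handles
  distances of at least 1.\<close>

lemma interleaved_holder:
  assumes "0 \<notin> S" "s > 0" and count: "\<And>n. s * real n - K \<le> real (card (S \<inter> {..n}))"
    and "t \<in> {0..<1}" "u \<in> {0..<1}"
  shows "\<bar>t - u\<bar> \<le> max 1 (2 * 2 powr (K + s)) *
     dist (binary_real (interleaved_digit S T t)) (binary_real (interleaved_digit S T u)) powr s"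
proof -
  let ?F = "\<lambda>t. binary_real (interleaved_digit S T t)"
  let ?d = "dist (?F t) (?F u)"
  have close: "\<bar>t - u\<bar> \<le> 2 * 2 powr K * 2 powr (- s * real n)" if "?d < 1 / 2 ^ n" for n
  proof -
    have "\<bar>t - u\<bar> \<le> 2 / 2 ^ card (S \<inter> {..n})"
    proof (cases "t \<le> u")
      case True
      then show ?thesis
        using interleaved_close[OF assms(1) _ True _ that] assms by simp
    next
      case False
      then show ?thesis
        using interleaved_close[OF assms(1), of u t T n] that assms by (simp add: dist_commute)
    qed
    also have "\<dots> = 2 * 2 powr (- real (card (S \<inter> {..n})))"
      by (simp add: powr_minus powr_realpow field_simps)
    also have "\<dots> \<le> 2 * 2 powr (K - s * real n)"
      using count[of n] by simp
    also have "\<dots> = 2 * 2 powr K * 2 powr (- s * real n)"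
      by (simp flip: powr_add)
    finally show ?thesis .
  qed
  consider "?d = 0" | "?d \<ge> 1" | "0 < ?d" "?d < 1"
    using zero_le_dist[of "?F t" "?F u"] by linarith
  then show ?thesis
  proof cases
    case 1
    \<comment> \<open>As \<open>0 powr s = 0\<close>, equality of t and u is needed here; it follows
      from the estimate for all n.\<close>
    have lim: "(\<lambda>n. 2 * 2 powr K * 2 powr (real n * (- s))) \<longlonglongrightarrow> 2 * 2 powr K * 0"
      by (intro tendsto_intros tendsto_powr_mult_zero) (use assms in auto)
    have "\<bar>t - u\<bar> \<le> 2 * 2 powr K * 2 powr (real n * (- s))" for n
      using close[of n] 1 by (simp add: mult.commute)
    then have "\<bar>t - u\<bar> \<le> 2 * 2 powr K * 0"
      by (intro LIMSEQ_le_const[OF lim] exI[of _ 0]) blast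
    then show ?thesis
      using 1 by simp
  next
    case 2
    have "\<bar>t - u\<bar> \<le> 1 * 1"
      using assms by auto
    also have "\<dots> \<le> max 1 (2 * 2 powr (K + s)) * ?d powr s"
      using 2 assms by (intro mult_mono ge_one_powr_ge_zero) auto
    finally show ?thesis .
  next
    case 3
    obtain n0 where "(1/2) ^ n0 < ?d"
      using real_arch_pow_inv[OF 3(1), of "1/2"] by auto
    then have ex: "\<exists>n. 1 / 2 ^ n \<le> ?d"
      by (intro exI[of _ n0]) (simp add: power_one_over)
    define N where "N = (LEAST n. 1 / 2 ^ n \<le> ?d)"
    have N: "1 / 2 ^ N \<le> ?d"
      unfolding N_def by (rule LeastI_ex[OF ex])
    then obtain n where n: "N = Suc n"
      using 3 by (cases N) auto
    then have "\<not> 1 / 2 ^ n \<le> ?d"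
      using not_less_Least[of n "\<lambda>n. 1 / 2 ^ n \<le> ?d"] by (simp add: N_def[symmetric])
    then have "\<bar>t - u\<bar> \<le> 2 * 2 powr K * 2 powr (- s * real n)"
      by (intro close) simp
    also have "2 powr (- s * real n) = 2 powr s * (1 / 2 ^ Suc n) powr s"
    proof -
      have "1 / 2 ^ Suc n = (2::real) powr (- real (Suc n))"
        unfolding powr_minus by (subst powr_realpow) (simp_all add: field_simps)
      then have "2 powr s * (1 / 2 ^ Suc n) powr s = 2 powr (s + - real (Suc n) * s)"
        by (simp only: powr_powr powr_add)
      then show ?thesis
        by (simp add: algebra_simps)
    qed
    also have "2 * 2 powr K * (2 powr s * (1 / 2 ^ Suc n) powr s) = 2 * 2 powr (K + s) * (1 / 2 ^ Suc n) powr s"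
      by (simp add: powr_add)
    also have "\<dots> \<le> max 1 (2 * 2 powr (K + s)) * ?d powr s"
      using N n assms by (intro mult_mono powr_mono2) auto
    finally show ?thesis .
  qed
qed

section \<open>A Cantor set with prescribed approximation exponent\<close>

lemma floor_sqrt_ex:
  fixes l :: nat
  obtains m where "m\<^sup>2 \<le> l" "l < (Suc m)\<^sup>2"
proof -
  define n where "n = (LEAST n. l < n\<^sup>2)"
  have ex: "\<exists>n. l < n\<^sup>2"
    by (intro exI[of _ "Suc l"]) (simp add: power2_eq_square)
  then have n: "l < n\<^sup>2"
    unfolding n_def by (rule LeastI_ex)
  then obtain m where m: "n = Suc m"
    by (cases n) auto
  then have "\<not> l < m\<^sup>2"
    using not_less_Least[of m "\<lambda>n. l < n\<^sup>2"] by (simp add: n_def[symmetric])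
  then show ?thesis
    using n m by (intro that[of m]) auto
qed

text \<open>Ensures that the zeros forced at \<open>m\<^sup>2 + 1\<close> do not collide with the
  ones at squares.\<close>

lemma Suc_square_not_square: "m \<ge> 1 \<Longrightarrow> m\<^sup>2 + 1 \<noteq> (n\<^sup>2 :: nat)"
proof
  assume m: "m \<ge> 1" and eq: "m\<^sup>2 + 1 = n\<^sup>2"
  have "m\<^sup>2 < n\<^sup>2"
    using eq by simp
  then have "m < n"
    by (rule power_less_imp_less_base) simp
  then have "(m + 1)\<^sup>2 \<le> n\<^sup>2"
    by (intro power_mono) auto
  then show False
    using eq m by (simp add: power2_eq_square)
qed

lemma card_nat_le_real:
  assumes "0 \<le> c"
  shows "finite {i::nat. real i \<le> c}" "real (card {i::nat. real i \<le> c}) \<le> c + 1"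
proof -
  have "{i::nat. real i \<le> c} = {..nat \<lfloor>c\<rfloor>}"
    using assms by (auto simp: le_nat_floor le_floor_iff) linarith
  then show "finite {i::nat. real i \<le> c}" "real (card {i::nat. real i \<le> c}) \<le> c + 1"
    using assms by simp_all
qed

text \<open>A point of the Cantor set has arbitrary binary digits in the free positions, ones in the
  positions \<open>m\<^sup>2\<close> outside the gaps, and zeros elsewhere. The long runs of zeros in the gaps
  \<open>(gap_start k)\<^sup>2 < i < (gap_end k)\<^sup>2\<close>, whose ends have ratio about \<open>\<tau>\<close>, provide the good dyadic
  approximations. The forced digits at \<open>m\<^sup>2\<close> and \<open>m\<^sup>2 + 1\<close> exclude better ones at the cost of only
  \<open>O(sqrt n)\<close> of the first \<open>n\<close> digits. Gap bounds are squares so that each gap ends with a one,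
  and \<open>gap_start (k + 1) = (gap_start k)\<^sup>2\<close> makes all earlier gaps negligible.\<close>

definition gap_start :: "real \<Rightarrow> nat \<Rightarrow> nat" where
  "gap_start \<tau> k = (nat \<lceil>\<tau>\<rceil> + 1) ^ 2 ^ k"

definition gap_end :: "real \<Rightarrow> nat \<Rightarrow> nat" where
  "gap_end \<tau> k = nat \<lceil>sqrt \<tau> * real (gap_start \<tau> k)\<rceil>"

definition one_positions :: "real \<Rightarrow> nat set" where
  "one_positions \<tau> = {m\<^sup>2 | m. \<forall>k. \<not> (gap_start \<tau> k < m \<and> m < gap_end \<tau> k)}"

definition free_positions :: "real \<Rightarrow> nat set" where
  "free_positions \<tau> = {i. (\<forall>m. i \<noteq> m\<^sup>2 \<and> i \<noteq> m\<^sup>2 + 1) \<and>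
     (\<forall>k. \<not> ((gap_start \<tau> k)\<^sup>2 < i \<and> i < (gap_end \<tau> k)\<^sup>2))}"

section \<open>Growth and separation of the gaps\<close>

context
  fixes \<tau> :: real
  assumes \<tau>: "1 \<le> \<tau>"
begin

lemma gap_start_pos: "0 < gap_start \<tau> k"
  by (simp add: gap_start_def)

lemma gap_start_Suc: "gap_start \<tau> (Suc k) = (gap_start \<tau> k)\<^sup>2"
  by (simp add: gap_start_def power_mult[symmetric] mult.commute)

lemma gap_start_mono: "j \<le> k \<Longrightarrow> gap_start \<tau> j \<le> gap_start \<tau> k"
  by (simp add: gap_start_def power_increasing)

lemma gap_start_ge: "k \<le> gap_start \<tau> k"
proof -
  have "k \<le> 2 ^ k"
    by (simp add: less_imp_le)
  also have "(2::nat) ^ k \<le> 2 ^ 2 ^ k"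
    by (intro power_increasing) (simp_all add: less_imp_le)
  also have "\<dots> \<le> gap_start \<tau> k"
    unfolding gap_start_def using \<tau> by (intro power_mono) linarith+
  finally show ?thesis .
qed

lemma gap_start_square_ge: "k \<le> (gap_start \<tau> k)\<^sup>2"
  using gap_start_ge[of "Suc k"] by (simp add: gap_start_Suc)

lemma sqrt_ratio: "1 \<le> sqrt \<tau>" "sqrt \<tau> * sqrt \<tau> = \<tau>"
  using \<tau> by auto

lemma gap_end_bounds:
  "sqrt \<tau> * real (gap_start \<tau> k) \<le> real (gap_end \<tau> k)"
  "real (gap_end \<tau> k) \<le> sqrt \<tau> * real (gap_start \<tau> k) + 1"
proof -
  have "0 \<le> sqrt \<tau> * real (gap_start \<tau> k)"
    using \<tau> by simp
  then show "sqrt \<tau> * real (gap_start \<tau> k) \<le> real (gap_end \<tau> k)"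
    "real (gap_end \<tau> k) \<le> sqrt \<tau> * real (gap_start \<tau> k) + 1"
    unfolding gap_end_def by linarith+
qed

lemma gap_end_mono: "j \<le> k \<Longrightarrow> gap_end \<tau> j \<le> gap_end \<tau> k"
  unfolding gap_end_def using \<tau>
  by (intro nat_mono ceiling_mono mult_left_mono of_nat_mono gap_start_mono) auto

text \<open>Every gap start is at least \<tau>, hence at least \<open>sqrt \<tau>\<close>, so
  squaring it reaches at least as far as multiplying by \<open>sqrt \<tau>\<close>. Thus the gaps do
  not overlap.\<close>

lemma gap_end_le_next: "gap_end \<tau> k \<le> gap_start \<tau> (Suc k)"
proof -
  have "sqrt \<tau> \<le> \<tau>"
    using \<tau> sqrt_ratio mult_left_mono[of 1 "sqrt \<tau>" "sqrt \<tau>"] by simp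
  also have "\<tau> \<le> real (gap_start \<tau> 0)"
    by (simp add: gap_start_def) linarith
  also have "\<dots> \<le> real (gap_start \<tau> k)"
    using gap_start_mono[of 0 k] by simp
  finally have "sqrt \<tau> * real (gap_start \<tau> k) \<le> real (gap_start \<tau> k) * real (gap_start \<tau> k)"
    by (rule mult_right_mono) simp
  also have "\<dots> = real (gap_start \<tau> (Suc k))"
    by (simp add: gap_start_Suc power2_eq_square)
  finally show ?thesis
    unfolding gap_end_def by simp
qed

lemma one_positions_not_free: "i \<in> one_positions \<tau> \<Longrightarrow> i \<notin> free_positions \<tau>"
  by (auto simp: one_positions_def free_positions_def)

lemma zero_not_free: "0 \<notin> free_positions \<tau>"
  by (auto simp: free_positions_def intro!: exI[of _ 0])

text \<open>The witness is the next square after l, or the squared end of the gap that contains its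
  root. In both cases the root of the witness is at most \<open>sqrt \<tau> * a + 1\<close> for some
  a with \<open>a\<^sup>2 \<le> l\<close>.\<close>

lemma next_one_position:
  fixes l :: nat
  obtains i where "i \<in> one_positions \<tau>" "l < i" "real i \<le> (sqrt (\<tau> * real l) + 1)\<^sup>2"
proof -
  obtain m where m: "m\<^sup>2 \<le> l" "l < (Suc m)\<^sup>2"
    by (rule floor_sqrt_ex)
  have bnd: "sqrt \<tau> * real a + 1 \<le> sqrt (\<tau> * real l) + 1" if "a\<^sup>2 \<le> l" for a
  proof -
    have "real (a\<^sup>2) \<le> real l"
      using that by (simp only: of_nat_le_iff)
    then have "real a \<le> sqrt (real l)"
      by (intro real_le_rsqrt) simp
    then show ?thesis
      using \<tau> by (simp add: real_sqrt_mult mult_left_mono)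
  qed
  show ?thesis
  proof (cases "\<exists>k. gap_start \<tau> k < Suc m \<and> Suc m < gap_end \<tau> k")
    case False
    have "real (Suc m) \<le> sqrt \<tau> * real m + 1"
      using sqrt_ratio mult_right_mono[of 1 "sqrt \<tau>" "real m"] by simp
    also have "\<dots> \<le> sqrt (\<tau> * real l) + 1"
      by (rule bnd[OF m(1)])
    finally have "(real (Suc m))\<^sup>2 \<le> (sqrt (\<tau> * real l) + 1)\<^sup>2"
      by (rule power_mono) simp
    then show ?thesis
      using m False by (intro that[of "(Suc m)\<^sup>2"]) (auto simp: one_positions_def)
  next
    case True
    then obtain k where k: "gap_start \<tau> k \<le> m" "Suc m < gap_end \<tau> k"
      by (auto simp: less_Suc_eq_le)
    \<comment> \<open>The end of gap k lies in no gap: earlier ones end no later, and later ones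
      start no earlier.\<close>
    have "\<not> (gap_start \<tau> j < gap_end \<tau> k \<and> gap_end \<tau> k < gap_end \<tau> j)" for j
    proof (cases "j \<le> k")
      case True
      then show ?thesis
        using gap_end_mono[of j k] by simp
    next
      case False
      then show ?thesis
        using gap_start_mono[of "Suc k" j] gap_end_le_next[of k] by simp
    qed
    then have "(gap_end \<tau> k)\<^sup>2 \<in> one_positions \<tau>"
      unfolding one_positions_def by blast
    moreover have "l < (gap_end \<tau> k)\<^sup>2"
      by (rule less_le_trans[OF m(2) power_mono]) (use k in auto)
    moreover have "(gap_start \<tau> k)\<^sup>2 \<le> l"
      using power_mono[OF k(1) le0, of 2] m(1) by linarith
    then have "real (gap_end \<tau> k) \<le> sqrt (\<tau> * real l) + 1"
      using gap_end_bounds(2)[of k] bnd by (meson order_trans)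
    then have "(real (gap_end \<tau> k))\<^sup>2 \<le> (sqrt (\<tau> * real l) + 1)\<^sup>2"
      by (rule power_mono) simp
    ultimately show ?thesis
      by (intro that[of "(gap_end \<tau> k)\<^sup>2"]) auto
  qed
qed

text \<open>The successor of the next square is not a square and is excluded from the free
  positions, so it carries a zero.\<close>

lemma next_zero_position:
  fixes l :: nat
  obtains i where "i \<notin> one_positions \<tau>" "i \<notin> free_positions \<tau>" "l < i"
    "real i \<le> (sqrt (\<tau> * real l) + 1)\<^sup>2 + 1"
proof -
  obtain m where m: "m\<^sup>2 \<le> l" "l < (Suc m)\<^sup>2"
    by (rule floor_sqrt_ex)
  have "real (m\<^sup>2) \<le> real l"
    using m(1) by (simp only: of_nat_le_iff)
  also have "real l \<le> \<tau> * real l"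
    using \<tau> mult_right_mono[of 1 \<tau> "real l"] by simp
  finally have "real m \<le> sqrt (\<tau> * real l)"
    by (intro real_le_rsqrt) simp
  then have "(real (Suc m))\<^sup>2 \<le> (sqrt (\<tau> * real l) + 1)\<^sup>2"
    by (intro power_mono) auto
  moreover have "(Suc m)\<^sup>2 + 1 \<notin> one_positions \<tau>"
    unfolding one_positions_def using Suc_square_not_square[of "Suc m"] by force
  moreover have "(Suc m)\<^sup>2 + 1 \<notin> free_positions \<tau>"
    unfolding free_positions_def by blast
  ultimately show ?thesis
    using m by (intro that[of "(Suc m)\<^sup>2 + 1"]) auto
qed

lemma gap_positions_zero:
  assumes "(gap_start \<tau> k)\<^sup>2 < i" "i < (gap_end \<tau> k)\<^sup>2"
  shows "i \<notin> one_positions \<tau>" "i \<notin> free_positions \<tau>"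
proof -
  show "i \<notin> free_positions \<tau>"
    using assms by (auto simp: free_positions_def)
  show "i \<notin> one_positions \<tau>"
  proof
    assume "i \<in> one_positions \<tau>"
    then obtain m where m: "i = m\<^sup>2" "\<not> (gap_start \<tau> k < m \<and> m < gap_end \<tau> k)"
      unfolding one_positions_def by blast
    have "gap_start \<tau> k < m" "m < gap_end \<tau> k"
      using assms unfolding m(1) by (auto intro: power_less_imp_less_base)
    then show False
      using m(2) by simp
  qed
qed

section \<open>Approximation exponent of the points of the Cantor set\<close>

definition cantor_point :: "real \<Rightarrow> real" where
  "cantor_point t = binary_real (interleaved_digit (free_positions \<tau>) (one_positions \<tau>) t)"

text \<open>At the level \<open>a\<^sup>2\<close> where a gap starts, the following zeros reach up
  to about \<tau> times that level. The distance is at most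
  \<open>2 powr (- a\<^sup>2 * \<tau>)\<close> up to a factor 2, which \<sigma> < \<tau>
  absorbs.\<close>

lemma cantor_point_approximable:
  assumes "0 < \<sigma>" "\<sigma> < \<tau>"
  shows "cantor_point t \<in> dyadic_approximable \<sigma>"
proof -
  let ?e = "interleaved_digit (free_positions \<tau>) (one_positions \<tau>) t"
  have close: "dyadic_dist ((gap_start \<tau> k)\<^sup>2) (cantor_point t) \<le> 2 * 2 powr (- real ((gap_start \<tau> k)\<^sup>2) * \<tau>)" for k
  proof -
    define a b where "a = gap_start \<tau> k" and "b = gap_end \<tau> k"
    \<comment> \<open>For an empty gap the subtraction is truncated to 0, and the exponent is still
      at least \<open>b\<^sup>2 - 1\<close>.\<close>
    have "dyadic_dist (a\<^sup>2) (binary_real ?e) \<le> 1 / 2 ^ (a\<^sup>2 + (b\<^sup>2 - 1 - a\<^sup>2))"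
    proof (rule dyadic_dist_binary_le[OF interleaved_digit_bit])
      fix i assume "a\<^sup>2 < i" "i \<le> a\<^sup>2 + (b\<^sup>2 - 1 - a\<^sup>2)"
      then show "?e i = 0"
        using gap_positions_zero[of k i] by (simp add: a_def b_def interleaved_digit_def)
    qed
    also have "\<dots> = 2 powr (- real (a\<^sup>2 + (b\<^sup>2 - 1 - a\<^sup>2)))"
      by (simp only: powr_minus powr_realpow zero_less_numeral inverse_eq_divide)
    also have "\<dots> \<le> 2 powr (1 - real (a\<^sup>2) * \<tau>)"
    proof -
      have "(sqrt \<tau> * real a)\<^sup>2 \<le> (real b)\<^sup>2"
        using gap_end_bounds(1)[of k] \<tau> by (intro power_mono) (auto simp: a_def b_def)
      then have "real (a\<^sup>2) * \<tau> \<le> real (b\<^sup>2)"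
        using \<tau> by (simp add: power_mult_distrib mult.commute)
      moreover have "real (b\<^sup>2) - 1 \<le> real (a\<^sup>2 + (b\<^sup>2 - 1 - a\<^sup>2))"
        by linarith
      ultimately show ?thesis
        by (intro powr_mono) linarith+
    qed
    also have "\<dots> = 2 * 2 powr (- real (a\<^sup>2) * \<tau>)"
      by (simp add: powr_diff powr_minus_divide)
    finally show ?thesis
      by (simp add: a_def cantor_point_def)
  qed
  have lim: "(\<lambda>l. 2 * 2 powr (real l * (\<sigma> - \<tau>))) \<longlonglongrightarrow> 2 * 0"
    by (intro tendsto_intros tendsto_powr_mult_zero) (use assms in auto)
  have "\<forall>\<^sub>F l in sequentially. 2 * 2 powr (real l * (\<sigma> - \<tau>)) < 1"
    by (rule order_tendstoD(2)[OF lim]) simp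
  then obtain L where L: "\<And>l. l \<ge> L \<Longrightarrow> 2 * 2 powr (real l * (\<sigma> - \<tau>)) < 1"
    unfolding eventually_sequentially by blast
  show ?thesis
    unfolding dyadic_approximable_def mem_Collect_eq frequently_sequentially
  proof
    fix N
    define l where "l = (gap_start \<tau> (max L N))\<^sup>2"
    have "max L N \<le> l"
      unfolding l_def by (rule gap_start_square_ge)
    have "dyadic_dist l (cantor_point t) \<le> 2 * 2 powr (- real l * \<tau>)"
      unfolding l_def by (rule close)
    also have "\<dots> = (2 * 2 powr (real l * (\<sigma> - \<tau>))) * 2 powr (- real l * \<sigma>)"
      by (simp add: algebra_simps flip: powr_add)
    also have "\<dots> \<le> 1 * 2 powr (- real l * \<sigma>)"
      using L[of l] \<open>max L N \<le> l\<close> by (intro mult_right_mono) auto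
    finally show "\<exists>n\<ge>N. dyadic_dist n (cantor_point t) \<le> 2 powr (- real n * \<sigma>)"
      using \<open>max L N \<le> l\<close> by (intro exI[of _ l]) simp
  qed
qed

text \<open>After every level l both a one and a zero occur within the first
  \<open>\<tau> * l + O(sqrt l)\<close> positions, so the grid distance is at least 2 to minus that
  number; \<sigma> > \<tau> outweighs the root term.\<close>

lemma cantor_point_not_approximable:
  assumes "\<tau> < \<sigma>"
  shows "cantor_point t \<notin> dyadic_approximable \<sigma>"
proof -
  let ?e = "interleaved_digit (free_positions \<tau>) (one_positions \<tau>) t"
  have far: "2 powr (- ((sqrt (\<tau> * real l) + 1)\<^sup>2 + 1)) \<le> dyadic_dist l (cantor_point t)" for l
  proof -
    obtain i where i: "i \<in> one_positions \<tau>" "l < i" "real i \<le> (sqrt (\<tau> * real l) + 1)\<^sup>2"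
      by (rule next_one_position)
    obtain j where j: "j \<notin> one_positions \<tau>" "j \<notin> free_positions \<tau>" "l < j"
        "real j \<le> (sqrt (\<tau> * real l) + 1)\<^sup>2 + 1"
      by (rule next_zero_position)
    define w where "w = max i j - l"
    have w: "l + w = max i j"
      using i(2) by (simp add: w_def)
    have "real (l + w) \<le> (sqrt (\<tau> * real l) + 1)\<^sup>2 + 1"
      unfolding w using i j by (simp add: max_def)
    then have "2 powr (- ((sqrt (\<tau> * real l) + 1)\<^sup>2 + 1)) \<le> 2 powr (- real (l + w))"
      by simp
    also have "\<dots> = 1 / 2 ^ (l + w)"
      by (simp only: powr_minus powr_realpow zero_less_numeral inverse_eq_divide)
    also have "\<dots> \<le> dyadic_dist l (cantor_point t)"
      unfolding cantor_point_def
      by (rule dyadic_dist_binary_ge[of ?e l i w j, OF interleaved_digit_bit])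
         (use i j w one_positions_not_free[OF i(1)] in \<open>auto simp: interleaved_digit_def\<close>)
    finally show ?thesis .
  qed
  have "\<forall>\<^sub>F l in sequentially. 2 * sqrt \<tau> * sqrt (real l) + 2 < (\<sigma> - \<tau>) * real l"
    using assms \<tau> by real_asymp
  then have "\<forall>\<^sub>F l in sequentially. (sqrt (\<tau> * real l) + 1)\<^sup>2 + 1 < real l * \<sigma>"
    by eventually_elim (use \<tau> in \<open>simp add: power2_sum real_sqrt_mult power_mult_distrib algebra_simps\<close>)
  then have "\<forall>\<^sub>F l in sequentially. \<not> dyadic_dist l (cantor_point t) \<le> 2 powr (- real l * \<sigma>)"
  proof eventually_elim
    case (elim l)
    then have "2 powr (- real l * \<sigma>) < 2 powr (- ((sqrt (\<tau> * real l) + 1)\<^sup>2 + 1))"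
      by simp
    then show ?case
      using far[of l] by linarith
  qed
  then show ?thesis
    by (simp add: dyadic_approximable_def frequently_def)
qed

section \<open>Density of the free positions\<close>

lemma last_gap_card:
  "real (card {i. (gap_start \<tau> k)\<^sup>2 < i \<and> i < (gap_end \<tau> k)\<^sup>2 \<and> i \<le> n}) \<le> (1 - 1 / \<tau>) * real n + 2 * sqrt (real n)"
proof -
  define a b where "a = gap_start \<tau> k" and "b = gap_end \<tau> k"
  have rhs: "0 \<le> (1 - 1 / \<tau>) * real n"
    using \<tau> by simp
  \<comment> \<open>In the middle range the share \<open>1 - a\<^sup>2 / n\<close> of the gap is at
    most \<open>1 - 1 / \<tau>\<close>. In the last the whole gap is counted, and rounding b up
    costs at most \<open>2 * sqrt \<tau> * a\<close>.\<close>
  consider "n < a\<^sup>2" | "a\<^sup>2 \<le> n" "real n \<le> \<tau> * (real a)\<^sup>2" | "\<tau> * (real a)\<^sup>2 \<le> real n"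
    by linarith
  then show ?thesis
  proof cases
    case 1
    then have "{i. a\<^sup>2 < i \<and> i < b\<^sup>2 \<and> i \<le> n} = {}"
      by auto
    then show ?thesis
      unfolding a_def b_def using rhs by (simp only: card.empty) simp
  next
    case 2
    have "card {i. a\<^sup>2 < i \<and> i < b\<^sup>2 \<and> i \<le> n} \<le> card {a\<^sup>2<..n}"
      by (intro card_mono) auto
    then have "real (card {i. a\<^sup>2 < i \<and> i < b\<^sup>2 \<and> i \<le> n}) \<le> real n - (real a)\<^sup>2"
      using 2(1) by (simp flip: of_nat_power)
    also have "\<dots> \<le> real n - real n / \<tau>"
      using 2(2) \<tau> by (simp add: divide_le_eq mult.commute)
    also have "\<dots> \<le> (1 - 1 / \<tau>) * real n + 2 * sqrt (real n)"
      by (simp add: algebra_simps)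
    finally show ?thesis
      by (simp add: a_def b_def)
  next
    case 3
    have "(sqrt \<tau> * real a)\<^sup>2 \<le> real n"
      using 3 \<tau> by (simp add: power_mult_distrib)
    then have root: "sqrt \<tau> * real a \<le> sqrt (real n)"
      by (rule real_le_rsqrt)
    have "a \<le> b"
    proof -
      have "real a \<le> sqrt \<tau> * real a"
        using sqrt_ratio mult_right_mono[of 1 "sqrt \<tau>" "real a"] by simp
      then have "real a \<le> real b"
        using gap_end_bounds(1)[of k] by (simp add: a_def b_def)
      then show ?thesis
        by simp
    qed
    have "card {i. a\<^sup>2 < i \<and> i < b\<^sup>2 \<and> i \<le> n} \<le> card {a\<^sup>2<..<b\<^sup>2}"
      by (intro card_mono) auto
    also have "\<dots> \<le> b\<^sup>2 - 1 - a\<^sup>2"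
      by simp
    finally have card: "card {i. a\<^sup>2 < i \<and> i < b\<^sup>2 \<and> i \<le> n} \<le> b\<^sup>2 - 1 - a\<^sup>2" .
    have "real (card {i. a\<^sup>2 < i \<and> i < b\<^sup>2 \<and> i \<le> n}) \<le> (sqrt \<tau> * real a + 1)\<^sup>2 - 1 - (real a)\<^sup>2"
    \<comment> \<open>For a = b the number \<open>b\<^sup>2 - 1 - a\<^sup>2\<close> is truncated to
      0, so the bound does not transfer to the reals as in the other case.\<close>
    proof (cases "a = b")
      case False
      then have "a\<^sup>2 < b\<^sup>2"
        using \<open>a \<le> b\<close> by (intro power_strict_mono) auto
      then have "card {i. a\<^sup>2 < i \<and> i < b\<^sup>2 \<and> i \<le> n} + 1 + a\<^sup>2 \<le> b\<^sup>2"
        using card by linarith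
      then have "real (card {i. a\<^sup>2 < i \<and> i < b\<^sup>2 \<and> i \<le> n} + 1 + a\<^sup>2) \<le> real (b\<^sup>2)"
        by (simp only: of_nat_le_iff)
      moreover have "(real b)\<^sup>2 \<le> (sqrt \<tau> * real a + 1)\<^sup>2"
        using gap_end_bounds(2)[of k] by (intro power_mono) (auto simp: a_def b_def)
      ultimately show ?thesis
        by simp
    next
      case True
      define x where "x = sqrt \<tau> * real a"
      have x: "real a \<le> x"
        using sqrt_ratio mult_right_mono[of 1 "sqrt \<tau>" "real a"] by (simp add: x_def)
      then have "real a * real a \<le> x * x" "0 \<le> x"
        by (auto intro!: mult_mono order_trans[OF of_nat_0_le_iff x])
      then have "0 \<le> (sqrt \<tau> * real a + 1)\<^sup>2 - 1 - (real a)\<^sup>2"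
        unfolding x_def[symmetric] by (simp add: power2_eq_square algebra_simps)
      moreover have "{i. a\<^sup>2 < i \<and> i < b\<^sup>2 \<and> i \<le> n} = {}"
        using True by auto
      ultimately show ?thesis
        by (simp only: card.empty)
    qed
    also have "\<dots> = (1 - 1 / \<tau>) * (\<tau> * (real a)\<^sup>2) + 2 * (sqrt \<tau> * real a)"
      using \<tau> by (simp add: power2_sum power_mult_distrib field_simps)
    also have "\<dots> \<le> (1 - 1 / \<tau>) * real n + 2 * sqrt (real n)"
      using 3 root \<tau> by (intro add_mono mult_left_mono) auto
    finally show ?thesis
      by (simp add: a_def b_def)
  qed
qed

text \<open>The end of gap j is at most \<open>sqrt \<tau> + 1\<close> times its start, and the
  square of that start is the start of the next gap, hence at most \<open>gap_start \<tau> k\<close>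
  and so at most \<open>sqrt n\<close>.\<close>

lemma earlier_gap_end:
  assumes "j < k" "(gap_start \<tau> k)\<^sup>2 \<le> n"
  shows "(real (gap_end \<tau> j))\<^sup>2 \<le> (sqrt \<tau> + 1)\<^sup>2 * sqrt (real n)"
proof -
  have "real (gap_end \<tau> j) \<le> sqrt \<tau> * real (gap_start \<tau> j) + 1 * real (gap_start \<tau> j)"
    using gap_end_bounds(2)[of j] gap_start_pos[of j] by simp
  also have "\<dots> = (sqrt \<tau> + 1) * real (gap_start \<tau> j)"
    by (simp add: distrib_right)
  finally have "(real (gap_end \<tau> j))\<^sup>2 \<le> ((sqrt \<tau> + 1) * real (gap_start \<tau> j))\<^sup>2"
    by (rule power_mono) simp
  also have "\<dots> = (sqrt \<tau> + 1)\<^sup>2 * real (gap_start \<tau> (Suc j))"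
    by (simp add: power_mult_distrib gap_start_Suc)
  also have "\<dots> \<le> (sqrt \<tau> + 1)\<^sup>2 * sqrt (real n)"
  proof (rule mult_left_mono)
    have "gap_start \<tau> (Suc j) \<le> gap_start \<tau> k"
      using assms(1) by (intro gap_start_mono) simp
    then have "(gap_start \<tau> (Suc j))\<^sup>2 \<le> n"
      using power_mono[of "gap_start \<tau> (Suc j)" "gap_start \<tau> k" 2] assms(2) by linarith
    then have "real ((gap_start \<tau> (Suc j))\<^sup>2) \<le> real n"
      by (simp only: of_nat_le_iff)
    then show "real (gap_start \<tau> (Suc j)) \<le> sqrt (real n)"
      by (intro real_le_rsqrt) simp
  qed simp
  finally show ?thesis .
qed

lemma nonfree_subset:
  "\<exists>k. {..n} - free_positions \<tau> \<subseteq>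
     power2 ` {m. real m \<le> sqrt (real n)} \<union> (\<lambda>m. m\<^sup>2 + 1) ` {m. real m \<le> sqrt (real n)} \<union>
     {i. real i \<le> (sqrt \<tau> + 1)\<^sup>2 * sqrt (real n)} \<union>
     {i. (gap_start \<tau> k)\<^sup>2 < i \<and> i < (gap_end \<tau> k)\<^sup>2 \<and> i \<le> n}"
proof -
  \<comment> \<open>The last gap to begin by n. If there is none the value is unspecified, but then
    no position up to n lies in a gap.\<close>
  define k where "k = (GREATEST k. (gap_start \<tau> k)\<^sup>2 \<le> n)"
  have bound: "j \<le> n" if "(gap_start \<tau> j)\<^sup>2 \<le> n" for j
    using gap_start_square_ge that by (rule order_trans)
  show ?thesis
  proof (intro exI[of _ k] subsetI)
    fix i assume "i \<in> {..n} - free_positions \<tau>"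
    then have i: "i \<le> n" "i \<notin> free_positions \<tau>"
      by auto
    have root: "real m \<le> sqrt (real n)" if "m\<^sup>2 \<le> i" for m
    proof -
      have "real (m\<^sup>2) \<le> real n"
        using that i(1) by (simp only: of_nat_le_iff)
      then show ?thesis
        by (intro real_le_rsqrt) simp
    qed
    from i(2) consider m where "i = m\<^sup>2" | m where "i = m\<^sup>2 + 1"
      | j where "(gap_start \<tau> j)\<^sup>2 < i" "i < (gap_end \<tau> j)\<^sup>2"
      unfolding free_positions_def by blast
    then show "i \<in> power2 ` {m. real m \<le> sqrt (real n)} \<union> (\<lambda>m. m\<^sup>2 + 1) ` {m. real m \<le> sqrt (real n)} \<union>
     {i. real i \<le> (sqrt \<tau> + 1)\<^sup>2 * sqrt (real n)} \<union>
     {i. (gap_start \<tau> k)\<^sup>2 < i \<and> i < (gap_end \<tau> k)\<^sup>2 \<and> i \<le> n}"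
    proof cases
      case (3 j)
      then have j: "(gap_start \<tau> j)\<^sup>2 \<le> n"
        using i(1) by simp
      have "j \<le> k"
        unfolding k_def by (rule Greatest_le_nat[where P = "\<lambda>k. (gap_start \<tau> k)\<^sup>2 \<le> n", OF j bound])
      moreover have "(gap_start \<tau> k)\<^sup>2 \<le> n"
        unfolding k_def by (rule GreatestI_nat[where P = "\<lambda>k. (gap_start \<tau> k)\<^sup>2 \<le> n", OF j bound])
      ultimately show ?thesis
      proof (cases "j = k")
        case False
        have "real i \<le> real ((gap_end \<tau> j)\<^sup>2)"
          using 3(2) by (simp only: of_nat_le_iff less_imp_le)
        also have "\<dots> \<le> (sqrt \<tau> + 1)\<^sup>2 * sqrt (real n)"
          using earlier_gap_end[of j k n] \<open>j \<le> k\<close> False \<open>(gap_start \<tau> k)\<^sup>2 \<le> n\<close> by simp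
        finally show ?thesis
          by blast
      qed (use 3 i in auto)
    qed (use root in auto)
  qed
qed

text \<open>The complement is counted: the two families at squares give \<open>2 * sqrt n\<close>,
  the earlier gaps \<open>(sqrt \<tau> + 1)\<^sup>2 * sqrt n\<close>, the last gap
  \<open>(1 - 1 / \<tau>) * n + 2 * sqrt n\<close>, up to constants.\<close>

lemma free_positions_count:
  "real n / \<tau> - (4 + (sqrt \<tau> + 1)\<^sup>2) * sqrt (real n) - 3 \<le> real (card (free_positions \<tau> \<inter> {..n}))"
proof -
  define r where "r = sqrt (real n)"
  define c where "c = (sqrt \<tau> + 1)\<^sup>2 * r"
  have "r \<ge> 0" "c \<ge> 0"
    by (auto simp: r_def c_def)
  obtain k where k: "{..n} - free_positions \<tau> \<subseteq>
     power2 ` {m. real m \<le> r} \<union> (\<lambda>m. m\<^sup>2 + 1) ` {m. real m \<le> r} \<union>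
     {i. real i \<le> c} \<union> {i. (gap_start \<tau> k)\<^sup>2 < i \<and> i < (gap_end \<tau> k)\<^sup>2 \<and> i \<le> n}"
    (is "_ \<subseteq> ?A \<union> ?B \<union> ?C \<union> ?G")
    using nonfree_subset[of n] unfolding r_def c_def by blast
  note fin = card_nat_le_real[OF \<open>r \<ge> 0\<close>] card_nat_le_real[OF \<open>c \<ge> 0\<close>]
  have "finite ?G"
    by (rule finite_subset[of _ "{..n}"]) auto
  then have "card ({..n} - free_positions \<tau>) \<le> card (?A \<union> ?B \<union> ?C \<union> ?G)"
    using k fin by (intro card_mono) auto
  also have "\<dots> \<le> card ?A + card ?B + card ?C + card ?G"
    by (meson add_mono card_Un_le order_refl order_trans)
  also have "\<dots> \<le> card {m::nat. real m \<le> r} + card {m::nat. real m \<le> r} + card ?C + card ?G"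
    using fin by (intro add_mono card_image_le) auto
  finally have "real (card ({..n} - free_positions \<tau>)) \<le>
      real (card {m::nat. real m \<le> r}) + real (card {m::nat. real m \<le> r}) + real (card ?C) + real (card ?G)"
    by (simp flip: of_nat_add)
  also have "\<dots> \<le> (r + 1) + (r + 1) + (c + 1) + ((1 - 1 / \<tau>) * real n + 2 * r)"
    using fin last_gap_card[of k n] unfolding r_def[symmetric] by (intro add_mono) auto
  finally have "real (card ({..n} - free_positions \<tau>)) \<le> (1 - 1 / \<tau>) * real n + 4 * r + c + 3"
    by simp
  moreover have "card (free_positions \<tau> \<inter> {..n}) + card ({..n} - free_positions \<tau>) = card {..n}"
    using card_Int_Diff[of "{..n}" "free_positions \<tau>"] by (simp add: Int_commute)
  then have "real (card (free_positions \<tau> \<inter> {..n})) + real (card ({..n} - free_positions \<tau>)) = real n + 1"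
    by (simp flip: of_nat_add)
  ultimately show ?thesis
    unfolding r_def[symmetric] by (simp add: c_def[unfolded r_def, folded r_def] algebra_simps)
qed

lemma free_positions_density:
  assumes "s < 1 / \<tau>"
  shows "\<exists>K. \<forall>n. s * real n - K \<le> real (card (free_positions \<tau> \<inter> {..n}))"
proof (intro exI allI)
  fix n
  define M where "M = 4 + (sqrt \<tau> + 1)\<^sup>2"
  define d where "d = 1 / \<tau> - s"
  have "d > 0"
    using assms by (simp add: d_def)
  define r where "r = sqrt (real n)"
  have r: "real n = r\<^sup>2"
    by (simp add: r_def)
  \<comment> \<open>Completing the square bounds the loss \<open>M * sqrt n\<close> by
    \<open>d * n\<close> plus a constant.\<close>
  have "0 \<le> d * (r - M / (2 * d))\<^sup>2"
    using \<open>d > 0\<close> by simp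
  also have "\<dots> = d * r\<^sup>2 - M * r + M\<^sup>2 / (4 * d)"
    using \<open>d > 0\<close> by (simp add: power2_eq_square field_simps)
  finally have "s * real n - (3 + M\<^sup>2 / (4 * d)) \<le> real n / \<tau> - M * r - 3"
    by (simp add: r d_def algebra_simps)
  also have "\<dots> \<le> real (card (free_positions \<tau> \<inter> {..n}))"
    using free_positions_count[of n] by (simp add: M_def r_def)
  finally show "s * real n - (3 + (4 + (sqrt \<tau> + 1)\<^sup>2)\<^sup>2 / (4 * (1 / \<tau> - s))) \<le> real (card (free_positions \<tau> \<inter> {..n}))"
    by (simp only: M_def d_def)
qed

lemma cantor_point_hausdorff_measure:
  assumes "0 \<le> s" "s < 1 / \<tau>" "cantor_point ` {0..<1} \<subseteq> E"
  shows "hausdorff_measure s E \<noteq> 0"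
proof -
  \<comment> \<open>The exponent s' is positive even for s = 0, and below \<open>1 / \<tau>\<close>
    there is room for the loss of order \<open>sqrt n\<close>.\<close>
  obtain s' where s': "s < s'" "s' < 1 / \<tau>"
    using dense assms(2) by blast
  obtain K where K: "\<And>n. s' * real n - K \<le> real (card (free_positions \<tau> \<inter> {..n}))"
    using free_positions_density[OF s'(2)] by blast
  show ?thesis
  proof (rule hausdorff_measure_nonzeroI[where F = cantor_point])
    show "\<bar>t - u\<bar> \<le> max 1 (2 * 2 powr (K + s')) * dist (cantor_point t) (cantor_point u) powr s'"
      if "t \<in> {0..<1}" "u \<in> {0..<1}" for t u
      unfolding cantor_point_def
      by (rule interleaved_holder[OF zero_not_free _ K that]) (use s' assms in simp)
  qed (use s' assms in auto)
qed

end

section \<open>The spectrum\<close>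

lemma lower_holder_exponent_le_of_approximable:
  assumes "\<beta> > 1" "0 \<le> r" "\<And>r'. r < r' \<Longrightarrow> x \<in> dyadic_approximable (\<beta> / r')"
  shows "lower_holder_exponent (sawtooth_series \<beta>) x \<le> ereal r"
proof (rule ereal_le_epsilon2)
  fix e :: real assume "0 < e"
  then have "lower_holder_exponent (sawtooth_series \<beta>) x \<le> ereal (\<beta> / (\<beta> / (r + e)))"
    using assms by (intro lower_holder_exponent_le) auto
  then show "lower_holder_exponent (sawtooth_series \<beta>) x \<le> ereal r + ereal e"
    using assms by simp
qed

lemma lower_holder_exponent_ge_of_not_approximable:
  assumes "\<beta> > 1" "\<And>r'. 0 < r' \<Longrightarrow> r' < r \<Longrightarrow> x \<notin> dyadic_approximable (\<beta> / r')"
  shows "ereal r \<le> lower_holder_exponent (sawtooth_series \<beta>) x"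
proof (rule dense_le)
  fix y assume y: "y < ereal r"
  show "y \<le> lower_holder_exponent (sawtooth_series \<beta>) x"
  proof (cases "0 < y")
    case True
    then obtain r' where r': "y = ereal r'" "0 < r'" "r' < r"
      using y by (cases y) auto
    then have "ereal (\<beta> / (\<beta> / r')) \<le> lower_holder_exponent (sawtooth_series \<beta>) x"
      using assms by (intro lower_holder_exponent_ge) auto
    then show ?thesis
      using r' assms(1) by simp
  next
    case False
    then show ?thesis
      using lower_holder_exponent_nonneg[OF assms(1), of x] by simp
  qed
qed

text \<open>No point is farther than \<open>1 / 2 ^ l\<close> from the grid. Hence no exponent
  exceeds \<beta>, and the level sets above \<beta> are empty.\<close>

lemma dyadic_approximable_one: "x \<in> dyadic_approximable 1"
proof -
  have "dyadic_dist l x \<le> 2 powr (- real l * 1)" for l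
    using dyadic_dist_le_half[of l x] by (simp add: powr_minus powr_realpow inverse_eq_divide)
  then show ?thesis
    unfolding dyadic_approximable_def frequently_sequentially by auto
qed

lemma dyadic_approximable_zero: "0 \<in> dyadic_approximable \<tau>"
  unfolding dyadic_approximable_def frequently_sequentially by (auto simp: dyadic_dist_def)

lemma lower_spectrum_le:
  assumes "\<beta> > 1" "0 \<le> r"
  shows "lower_spectrum (sawtooth_series \<beta>) (ereal r) \<le> ereal (r / \<beta>)"
proof -
  let ?E = "{x. lower_holder_exponent (sawtooth_series \<beta>) x = ereal r}"
  have null: "hausdorff_measure s ?E = 0" if s: "r / \<beta> < s" for s
  proof -
    have "r < \<beta> * s"
      using s assms by (simp add: field_simps)
    \<comment> \<open>The lower inequality puts the level set into
      \<open>dyadic_approximable (\<beta> / r')\<close>; the upper one gives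
      \<open>s * (\<beta> / r') > 1\<close>, which makes that set null.\<close>
    then obtain r' where r': "r < r'" "r' < \<beta> * s"
      using dense by blast
    have "?E \<subseteq> dyadic_approximable (\<beta> / r')"
    proof clarify
      fix x assume x: "lower_holder_exponent (sawtooth_series \<beta>) x = ereal r"
      show "x \<in> dyadic_approximable (\<beta> / r')"
      proof (rule ccontr)
        assume "x \<notin> dyadic_approximable (\<beta> / r')"
        then have "ereal (\<beta> / (\<beta> / r')) \<le> ereal r"
          using lower_holder_exponent_ge[OF assms(1), of "\<beta> / r'" x] x r' assms by simp
        then show False
          using r' assms by simp
      qed
    qed
    moreover have "hausdorff_measure s (dyadic_approximable (\<beta> / r')) = 0"
      using r' assms by (intro hausdorff_measure_dyadic_approximable) (auto simp: field_simps)
    ultimately show ?thesis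
      by (rule hausdorff_measure_zero_subset[rotated])
  qed
  show ?thesis
    unfolding lower_spectrum_def hausdorff_dim_def
  proof (split if_split, intro conjI impI)
    show "Inf {ereal s |s. 0 \<le> s \<and> hausdorff_measure s ?E = 0} \<le> ereal (r / \<beta>)"
    proof (rule ereal_le_epsilon2)
      fix e :: real assume "0 < e"
      moreover have "0 \<le> r / \<beta>"
        using assms by simp
      ultimately have "Inf {ereal s |s. 0 \<le> s \<and> hausdorff_measure s ?E = 0} \<le> ereal (r / \<beta> + e)"
        using null[of "r / \<beta> + e"] by (intro Inf_lower) auto
      then show "Inf {ereal s |s. 0 \<le> s \<and> hausdorff_measure s ?E = 0} \<le> ereal (r / \<beta>) + ereal e"
        by simp
    qed
  qed simp
qed

lemma lower_spectrum_zero_ge: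
  assumes "\<beta> > 1"
  shows "0 \<le> lower_spectrum (sawtooth_series \<beta>) 0"
proof -
  have "lower_holder_exponent (sawtooth_series \<beta>) 0 \<le> ereal 0"
    by (rule lower_holder_exponent_le_of_approximable) (use assms dyadic_approximable_zero in auto)
  then have "lower_holder_exponent (sawtooth_series \<beta>) 0 = 0"
    using lower_holder_exponent_nonneg[OF assms, of 0] by (simp add: zero_ereal_def[symmetric])
  then have "{x. lower_holder_exponent (sawtooth_series \<beta>) x = 0} \<noteq> {}"
    by blast
  then show ?thesis
    unfolding lower_spectrum_def hausdorff_dim_def by (auto intro!: Inf_greatest)
qed

lemma lower_holder_exponent_cantor_point:
  assumes "\<beta> > 1" "0 < r" "r \<le> \<beta>"
  shows "lower_holder_exponent (sawtooth_series \<beta>) (cantor_point (\<beta> / r) t) = ereal r"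
proof (rule antisym)
  have \<tau>: "1 \<le> \<beta> / r"
    using assms by simp
  show "lower_holder_exponent (sawtooth_series \<beta>) (cantor_point (\<beta> / r) t) \<le> ereal r"
    by (rule lower_holder_exponent_le_of_approximable)
       (use assms in \<open>auto intro!: cantor_point_approximable[OF \<tau>] divide_strict_left_mono\<close>)
  show "ereal r \<le> lower_holder_exponent (sawtooth_series \<beta>) (cantor_point (\<beta> / r) t)"
    by (rule lower_holder_exponent_ge_of_not_approximable)
       (use assms in \<open>auto intro!: cantor_point_not_approximable[OF \<tau>] divide_strict_left_mono\<close>)
qed

lemma lower_spectrum_pos_ge:
  assumes "\<beta> > 1" "0 < r" "r \<le> \<beta>"
  shows "ereal (r / \<beta>) \<le> lower_spectrum (sawtooth_series \<beta>) (ereal r)"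
proof -
  let ?E = "{x. lower_holder_exponent (sawtooth_series \<beta>) x = ereal r}"
  have \<tau>: "1 \<le> \<beta> / r"
    using assms by simp
  have sub: "cantor_point (\<beta> / r) ` {0..<1} \<subseteq> ?E"
    using lower_holder_exponent_cantor_point[OF assms] by auto
  then have "?E \<noteq> {}"
    using lower_holder_exponent_cantor_point[OF assms, of 0] by blast
  moreover have "r / \<beta> \<le> s" if "0 \<le> s" "hausdorff_measure s ?E = 0" for s
    using cantor_point_hausdorff_measure[OF \<tau> that(1) _ sub] that(2) by (cases "s < r / \<beta>") auto
  ultimately show ?thesis
    unfolding lower_spectrum_def hausdorff_dim_def by (auto intro!: Inf_greatest)
qed

theorem proposition9:
  fixes \<beta> :: real and h :: ereal
  assumes "\<beta> > 1" and "h \<in> {0..\<infinity>}"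
  shows "lower_spectrum (sawtooth_series \<beta>) h =
           (if h \<in> {0..ereal \<beta>} then h / ereal \<beta> else -\<infinity>)"
proof (cases "h \<in> {0..ereal \<beta>}")
  case True
  then obtain r where r: "h = ereal r" "0 \<le> r" "r \<le> \<beta>"
    by (cases h) auto
  have "ereal (r / \<beta>) \<le> lower_spectrum (sawtooth_series \<beta>) (ereal r)"
    using lower_spectrum_zero_ge lower_spectrum_pos_ge assms r by (cases "r = 0") (auto simp: zero_ereal_def)
  with lower_spectrum_le[OF assms(1) r(2)] have "lower_spectrum (sawtooth_series \<beta>) h = ereal (r / \<beta>)"
    unfolding r(1) by (rule antisym)
  then show ?thesis
    using True r assms by simp
next
  case False
  have "lower_holder_exponent (sawtooth_series \<beta>) x \<le> ereal (\<beta> / 1)" for x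
    by (rule lower_holder_exponent_le[OF assms(1) zero_less_one dyadic_approximable_one])
  then have "{x. lower_holder_exponent (sawtooth_series \<beta>) x = h} = {}"
    using False assms(2) by auto
  then show ?thesis
    using False by (auto simp: lower_spectrum_def hausdorff_dim_def)
qed

end
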